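(* Let $I=(0,1)$ or $I=(0,\infty)$, let $\rho\in\mathcal P$, and let $E$ and $F$ be quasi-Banach ideal spaces on $I$ such that $E^{( * )}\neq\{0\}$, $F^{( * )}\neq\{0\}$ and the dilation operator $D_2$ is bounded both on $E^{\downarrow}$ and on $F^{\downarrow}$; let $A_E$, $A_F$ denote the best constants. Then: (i) $\rho(E^{( * )},F^{( * )})\neq\{0\}$, $\rho(E^{( * )},F^{( * )})\subset\rho(E,F)^{( * )}$, and $$\|x\|_{\rho(E,F)^{( * )}}\le C_1\|x\|_{\rho(E^{( * )},F^{( * )})}\quad\text{for all }x\in\rho(E^{( * )},F^{( * )}),$$ with $C_1\le\max(A_E,A_F)$. (ii) If, additionally, for some $r>0$ the operator $H_r^*$ is bounded on the spaces $E$ and $F$, then $\rho(E,F)^{( * )}\subset\rho(E^{( * )},F^{( * )})$ and $$\|x\|_{\rho(E^{( * )},F^{( * )})}\le C_2\|x\|_{\rho(E,F)^{( * )}}\quad\text{for all }x\in\rho(E,F)^{( * )},$$ with $C_2\le 2^{1/r}\max(1,2^{1/r-1})\cdot\max\left(A_E\|H_r^*\|_{E\to E},\,A_F\|H_r^*\|_{F\to F}\right)$. In particular, in this case the functional $\|\cdot\|_{\rho(E,F)^{( * )}}$ is a quasi-norm on $\rho(E,F)^{( * )}$, and $\rho(E,F)^{( * )}=\rho(E^{( * )},F^{( * )})$ (equal as sets, with equivalent quasi-norms).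
   Context: $I=(0,1)$ or $(0,\infty)$ with Lebesgue measure $m$; $L^0(I)$ is the space of (classes of) real measurable functions on $I$. A quasi-normed ideal space $E$ on $I$ is a linear subspace of $L^0(I)$ with a quasi-norm such that $y\in E$, $x\in L^0$, $|x|\le|y|$ a.e. imply $x\in E$ and $\|x\|_E\le\|y\|_E$; it is a quasi-Banach ideal space if complete. Such spaces are always assumed to have a weak unit (an element positive a.e. on $I$). $x^*(t)=\inf\{\lambda>0: m\{|x|>\lambda\}\le t\}$ is the nonincreasing rearrangement. The symmetrization of $E$ is $E^{( * )}=\{x\in L^0(I):x^*\in E\}$ with functional $\|x\|_{E^{( * )}}=\|x^*\|_E$. $E^{\downarrow}$ is the cone of all $x\in E$ with $x=x^*$. Dilation operator: $D_2x(t)=x(t/2)$, $t\in I$. "$D_2$ is bounded on $E^{\downarrow}$" means that there is a constant $1\le A<\infty$ with $\|D_2x\|_E\le A\|x\|_E$ for all $x\in E^{\downarrow}$; $A_E$ is the smallest such $A$. (Under this condition $E^{( * )}$ is a quasi-normed ideal space.) For $r>0$ and $l=m(I)$: $H_r^*x(t)=\left(\int_t^l\frac{|x(s)|^r}{s}\,ds\right)^{1/r}$. It is bounded on $E$ if there is $C$ with $H_r^*x\in E$ and $\|H_r^*x\|_E\le C\|x\|_E$ for all $x\in E$; $\|H_r^*\|_{E\to E}$ is the least such $C$. $\mathcal P$ is the set of concave nondecreasing functions $\rho_0:[0,\infty)\to[0,\infty)$ that vanish only at $0$, identified with the functions $\rho:[0,\infty)^2\to[0,\infty)$, $\rho(s,t)=s\rho_0(t/s)$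 for $s>0$ and $\rho(0,t)=0$. For quasi-normed ideal spaces $E,F$ the Calderón–Lozanovskiĭ space $\rho(E,F)$ is the set of $x\in L^0(I)$ such that $|x|\le\lambda\rho(|x_0|,|x_1|)$ a.e. for some $\lambda>0$ and some $x_0\in E$, $x_1\in F$ with $\|x_0\|_E\le1$, $\|x_1\|_F\le1$; $\|x\|_{\rho(E,F)}$ is the infimum of such $\lambda$. Accordingly $\|x\|_{\rho(E,F)^{( * )}}=\|x^*\|_{\rho(E,F)}$. *)

theory Defs
  imports "HOL-Analysis.Analysis"
begin

(* Elements of L0(I) are represented by functions real => real that are Lebesgue measurable on I.
   Spaces are sets of representatives, required to be closed under equality a.e. on I; values
   outside I are irrelevant. *)

definition L0 :: "real set \<Rightarrow> (real \<Rightarrow> real) set" where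
  "L0 I = borel_measurable (lebesgue_on I)"

record fspace =
  elems :: "(real \<Rightarrow> real) set"
  qnorm :: "(real \<Rightarrow> real) \<Rightarrow> real"

definition null_class :: "real set \<Rightarrow> (real \<Rightarrow> real) set" where
  "null_class I = {x \<in> L0 I. AE t in lebesgue_on I. x t = 0}"

definition linear_subspace :: "real set \<Rightarrow> (real \<Rightarrow> real) set \<Rightarrow> bool" where
  "linear_subspace I X \<longleftrightarrow>
     X \<subseteq> L0 I \<and> (\<lambda>t. 0) \<in> X \<and>
     (\<forall>x\<in>X. \<forall>y\<in>X. (\<lambda>t. x t + y t) \<in> X) \<and>
     (\<forall>x\<in>X. \<forall>c. (\<lambda>t. c * x t) \<in> X) \<and>
     (\<forall>x\<in>X. \<forall>y\<in>L0 I. (AE t in lebesgue_on I. x t = y t) \<longrightarrow> y \<in> X)"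

(* The last conjunct says that N is well defined on classes. *)
definition quasi_norm :: "real set \<Rightarrow> (real \<Rightarrow> real) set \<Rightarrow> ((real \<Rightarrow> real) \<Rightarrow> real) \<Rightarrow> bool" where
  "quasi_norm I X N \<longleftrightarrow>
     (\<forall>x\<in>X. 0 \<le> N x) \<and>
     (\<forall>x\<in>X. N x = 0 \<longleftrightarrow> (AE t in lebesgue_on I. x t = 0)) \<and>
     (\<forall>x\<in>X. \<forall>c. N (\<lambda>t. c * x t) = \<bar>c\<bar> * N x) \<and>
     (\<exists>K\<ge>1. \<forall>x\<in>X. \<forall>y\<in>X. N (\<lambda>t. x t + y t) \<le> K * (N x + N y)) \<and>
     (\<forall>x\<in>X. \<forall>y\<in>X. (AE t in lebesgue_on I. x t = y t) \<longrightarrow> N x = N y)"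

definition quasi_normed_space :: "real set \<Rightarrow> fspace \<Rightarrow> bool" where
  "quasi_normed_space I E \<longleftrightarrow> linear_subspace I (elems E) \<and> quasi_norm I (elems E) (qnorm E)"

definition has_weak_unit :: "real set \<Rightarrow> fspace \<Rightarrow> bool" where
  "has_weak_unit I E \<longleftrightarrow> (\<exists>w\<in>elems E. AE t in lebesgue_on I. 0 < w t)"

definition quasi_normed_ideal_space :: "real set \<Rightarrow> fspace \<Rightarrow> bool" where
  "quasi_normed_ideal_space I E \<longleftrightarrow>
     quasi_normed_space I E \<and>
     (\<forall>y\<in>elems E. \<forall>x\<in>L0 I. (AE t in lebesgue_on I. \<bar>x t\<bar> \<le> \<bar>y t\<bar>) \<longrightarrow>
        x \<in> elems E \<and> qnorm E x \<le> qnorm E y) \<and>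
     has_weak_unit I E"

definition qnorm_complete :: "fspace \<Rightarrow> bool" where
  "qnorm_complete E \<longleftrightarrow>
     (\<forall>X::nat \<Rightarrow> real \<Rightarrow> real.
        (\<forall>n. X n \<in> elems E) \<longrightarrow>
        (\<forall>e>0. \<exists>M. \<forall>m\<ge>M. \<forall>n\<ge>M. qnorm E (\<lambda>t. X m t - X n t) < e) \<longrightarrow>
        (\<exists>x\<in>elems E. (\<lambda>n. qnorm E (\<lambda>t. X n t - x t)) \<longlonglongrightarrow> 0))"

definition quasi_Banach_ideal_space :: "real set \<Rightarrow> fspace \<Rightarrow> bool" where
  "quasi_Banach_ideal_space I E \<longleftrightarrow> quasi_normed_ideal_space I E \<and> qnorm_complete E"

(* Rearrangements and Hardy-type integrals may take the value \<infinity>; such an ennreal-valued function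
   belongs to E iff it is finite a.e. on I and the resulting real function is in E. *)

definition ext_mem :: "real set \<Rightarrow> (real \<Rightarrow> ennreal) \<Rightarrow> fspace \<Rightarrow> bool" where
  "ext_mem I f E \<longleftrightarrow> (AE t in lebesgue_on I. f t < \<infinity>) \<and> (\<lambda>t. enn2real (f t)) \<in> elems E"

definition ext_norm :: "fspace \<Rightarrow> (real \<Rightarrow> ennreal) \<Rightarrow> real" where
  "ext_norm E f = qnorm E (\<lambda>t. enn2real (f t))"

(* Inf {} = \<infinity> in ennreal. *)
definition rearr :: "real set \<Rightarrow> (real \<Rightarrow> real) \<Rightarrow> real \<Rightarrow> ennreal" where
  "rearr I x t =
     Inf {ennreal c | c. 0 < c \<and> emeasure (lebesgue_on I) {s \<in> I. \<bar>x s\<bar> > c} \<le> ennreal t}"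

definition symmetrization :: "real set \<Rightarrow> fspace \<Rightarrow> fspace" where
  "symmetrization I E =
     \<lparr> elems = {x \<in> L0 I. ext_mem I (rearr I x) E},
       qnorm = (\<lambda>x. ext_norm E (rearr I x)) \<rparr>"

definition decreasing_cone :: "real set \<Rightarrow> fspace \<Rightarrow> (real \<Rightarrow> real) set" where
  "decreasing_cone I E =
     {x \<in> elems E. AE t in lebesgue_on I. 0 \<le> x t \<and> ennreal (x t) = rearr I x t}"

definition dilation2 :: "(real \<Rightarrow> real) \<Rightarrow> real \<Rightarrow> real" where
  "dilation2 x t = x (t / 2)"

definition dilation_consts :: "real set \<Rightarrow> fspace \<Rightarrow> real set" where
  "dilation_consts I E =
     {A. 1 \<le> A \<and> (\<forall>x\<in>decreasing_cone I E.
            dilation2 x \<in> elems E \<and> qnorm E (dilation2 x) \<le> A * qnorm E x)}"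

definition dilation_bounded :: "real set \<Rightarrow> fspace \<Rightarrow> bool" where
  "dilation_bounded I E \<longleftrightarrow> dilation_consts I E \<noteq> {}"

definition dilation_const :: "real set \<Rightarrow> fspace \<Rightarrow> real" where
  "dilation_const I E = Inf (dilation_consts I E)"

definition ennreal_powr :: "ennreal \<Rightarrow> real \<Rightarrow> ennreal" where
  "ennreal_powr z p = (if z = \<infinity> then \<infinity> else ennreal (enn2real z powr p))"

(* For I = (0,1) or (0,\<infinity>), l = m(I) and t in I, the interval (t,l) is {s \<in> I. t < s}. *)
definition Hstar :: "real set \<Rightarrow> real \<Rightarrow> (real \<Rightarrow> real) \<Rightarrow> real \<Rightarrow> ennreal" where
  "Hstar I r x t =
     ennreal_powr
       (\<integral>\<^sup>+s. ennreal (\<bar>x s\<bar> powr r / s) * indicator {s \<in> I. t < s} s \<partial>lebesgue_on I) (1 / r)"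

definition Hstar_consts :: "real set \<Rightarrow> real \<Rightarrow> fspace \<Rightarrow> real set" where
  "Hstar_consts I r E =
     {C. 0 \<le> C \<and> (\<forall>x\<in>elems E. ext_mem I (Hstar I r x) E \<and>
            ext_norm E (Hstar I r x) \<le> C * qnorm E x)}"

definition Hstar_bounded :: "real set \<Rightarrow> real \<Rightarrow> fspace \<Rightarrow> bool" where
  "Hstar_bounded I r E \<longleftrightarrow> Hstar_consts I r E \<noteq> {}"

definition Hstar_norm :: "real set \<Rightarrow> real \<Rightarrow> fspace \<Rightarrow> real" where
  "Hstar_norm I r E = Inf (Hstar_consts I r E)"

definition class_P :: "(real \<Rightarrow> real) set" where
  "class_P = {\<rho>0. concave_on {0..} \<rho>0 \<and> mono_on {0..} \<rho>0 \<and>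
     (\<forall>u\<ge>0. 0 \<le> \<rho>0 u) \<and> (\<forall>u\<ge>0. \<rho>0 u = 0 \<longleftrightarrow> u = 0)}"

(* The two-variable function on [0,\<infinity>)^2 identified with \<rho>0. *)
definition two_var :: "(real \<Rightarrow> real) \<Rightarrow> real \<Rightarrow> real \<Rightarrow> real" where
  "two_var \<rho>0 s t = (if 0 < s then s * \<rho>0 (t / s) else 0)"

definition CL_bounds ::
    "real set \<Rightarrow> (real \<Rightarrow> real) \<Rightarrow> fspace \<Rightarrow> fspace \<Rightarrow> (real \<Rightarrow> real) \<Rightarrow> real set" where
  "CL_bounds I \<rho>0 E F x =
     {c. 0 < c \<and> (\<exists>x0\<in>elems E. \<exists>x1\<in>elems F. qnorm E x0 \<le> 1 \<and> qnorm F x1 \<le> 1 \<and>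
            (AE t in lebesgue_on I. \<bar>x t\<bar> \<le> c * two_var \<rho>0 \<bar>x0 t\<bar> \<bar>x1 t\<bar>))}"

definition Calderon_Lozanovskii ::
    "real set \<Rightarrow> (real \<Rightarrow> real) \<Rightarrow> fspace \<Rightarrow> fspace \<Rightarrow> fspace" where
  "Calderon_Lozanovskii I \<rho>0 E F =
     \<lparr> elems = {x \<in> L0 I. CL_bounds I \<rho>0 E F x \<noteq> {}},
       qnorm = (\<lambda>x. Inf (CL_bounds I \<rho>0 E F x)) \<rparr>"

definition equivalent_on ::
    "(real \<Rightarrow> real) set \<Rightarrow> ((real \<Rightarrow> real) \<Rightarrow> real) \<Rightarrow> ((real \<Rightarrow> real) \<Rightarrow> real) \<Rightarrow> bool" where
  "equivalent_on X N M \<longleftrightarrow> (\<exists>a>0. \<exists>b>0. \<forall>x\<in>X. a * N x \<le> M x \<and> M x \<le> b * N x)"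

end

(* Rearranging x turns an inequality between x and rho(x0, x1) into one between decreasing functions at
   the price of the dilation t -> t/2, because {rho(x0, x1) > rho(a, b)} is contained in
   {x0 > a} \<union> {x1 > b}; this gives (i). For (ii), suppose x* \<le> rho(x0, x1). As x* decreases, x*(t) is below
   the r-th power mean of rho(x0, x1) over (t/2, t), which Jensen's inequality bounds by rho of the values
   of H_r^* x0 and H_r^* x1 at t/2. These two functions decrease, so they can be transported back along
   the level sets of x and their transports have rearrangements dominated by D_2 H_r^* x0 and
   D_2 H_r^* x1. *)

theory Submission
  imports Defs
begin

subsection \<open>Power inequalities and tangents of \<open>\<rho>\<close>\<close>

text \<open>The obstacle in (ii) is that the majorants of x* must be moved to the points where x
  itself lives, although |x| may be constant on sets of positive measure. No measure preserving map
  is constructed: a point s is sent to d/2, where d is the measure of {|x| >= |x s|}. All points of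
  one level set share the same d, and x* >= |x s| on all of (0,d), so the estimate on (d/2,d)
  applies to each s separately.

  This needs 0 < d < \<infinity>. Positivity holds for almost every s. Finiteness on the half line
  is a consequence of the Hardy operator, because the integral of 1/s diverges at infinity.

  Origin of 2^(1/r): the interval (d/2,d) has length d/2 and 1/s > 1/d on it, so the mean of |x0|^r
  there is at most twice the r-th power of H_r^* x0 at d/2.

  For the symmetrized Calderon-Lozanovskii space the quasi-triangle inequality is not attacked
  directly. It is carried over from the space built on the symmetrizations, whose definiteness comes
  from pointwise bounds on x*.\<close>

lemma powr_convex_closed:
  fixes p :: real
  assumes "p \<ge> 1"
  shows "convex_on {0..} (\<lambda>x. x powr p)"
proof (rule convex_onI)
  fix t x y :: real
  assume t: "0 < t" "t < 1" and xy: "x \<in> {0..}" "y \<in> {0..}"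
  \<comment> \<open>The endpoint 0 is included because the functions the inequality is applied to
    may vanish. With one point equal to 0, convexity reduces to s^p \<le> s for 0 < s < 1.\<close>
  have shrink: "(s * z) powr p \<le> s * z powr p" if "0 < s" "s < 1" "0 \<le> z" for s z :: real
  proof -
    have "s powr p \<le> s powr 1"
      using that assms by (intro powr_mono') auto
    then show ?thesis
      using that by (simp add: powr_mult mult_right_mono)
  qed
  consider "x = 0" | "y = 0" | "x > 0" "y > 0"
    using xy by fastforce
  then show "((1 - t) *\<^sub>R x + t *\<^sub>R y) powr p \<le> (1 - t) * x powr p + t * y powr p"
  proof cases
    case 1
    then show ?thesis using shrink[of t y] t xy by simp
  next
    case 2
    then show ?thesis using shrink[of "1 - t" x] t xy by simp
  next
    case 3
    then show ?thesis
      using convex_onD[OF powr_convex[OF assms], of t x y] t by simp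
  qed
qed simp

text \<open>Both sides are homogeneous of degree r, so one may normalise to u + w = 1, where z \<le>
  z^r holds for each summand.\<close>

lemma powr_sum_le:
  fixes r u w :: real
  assumes "0 < r" "r \<le> 1" "0 \<le> u" "0 \<le> w"
  shows "(u + w) powr r \<le> u powr r + w powr r"
proof (cases "u + w = 0")
  case False
  then have pos: "u + w > 0" using assms by linarith
  have frac: "z \<le> z powr r" if "0 \<le> z" "z \<le> 1" for z :: real
    using powr_mono'[of r 1 z] that assms by simp
  have "1 = u / (u + w) + w / (u + w)"
    using pos by (simp add: add_divide_distrib[symmetric])
  also have "\<dots> \<le> (u / (u + w)) powr r + (w / (u + w)) powr r"
    using assms pos by (intro add_mono frac) auto
  also have "\<dots> = (u powr r + w powr r) / (u + w) powr r"
    using assms pos by (simp add: powr_divide add_divide_distrib)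
  finally show ?thesis
    using pos by (simp add: field_simps)
qed (use assms in auto)

text \<open>The weights must not depend on \<xi> and \<eta>, since these become functions of s and
  the bound is integrated. For r \<ge> 1 convexity allows the weights p and q. For r < 1
  subadditivity gives p^r and q^r, whose sum is largest at p = q = 1/2; that value 2^(1-r) is the
  r-th power of 2^(1/r-1).\<close>

lemma powr_convex_combination_bound:
  fixes r p q :: real
  assumes "0 < r" "0 \<le> p" "0 \<le> q" "p + q = 1"
  obtains w1 w2 :: real
  where "0 \<le> w1" "0 \<le> w2" "w1 + w2 \<le> (max 1 (2 powr (1 / r - 1))) powr r"
    "\<And>\<xi> \<eta>. 0 \<le> \<xi> \<Longrightarrow> 0 \<le> \<eta> \<Longrightarrow> (p * \<xi> + q * \<eta>) powr r \<le> w1 * \<xi> powr r + w2 * \<eta> powr r"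
proof (cases "r \<ge> 1")
  case True
  have "1 \<le> (max 1 (2 powr (1 / r - 1))) powr r"
    using assms by (intro ge_one_powr_ge_zero) auto
  moreover have "(p * \<xi> + q * \<eta>) powr r \<le> p * \<xi> powr r + q * \<eta> powr r"
    if "0 \<le> \<xi>" "0 \<le> \<eta>" for \<xi> \<eta>
    using convex_onD[OF powr_convex_closed[OF True], of q \<xi> \<eta>] assms that
    by (simp add: eq_diff_eq[symmetric])
  ultimately show ?thesis
    using that[of p q] assms by simp
next
  case False
  then have r: "r < 1" "1 / r \<ge> 1" using assms by auto
  define k where "k = max 1 (2 powr (1 / r - 1))"
  have k: "k = 2 powr (1 / r - 1)"
    unfolding k_def using r by (intro max_absorb2 ge_one_powr_ge_zero) auto
  \<comment> \<open>Midpoint convexity of the power 1/r at p^r and q^r; the right-hand side is (p +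
    q)/2 = 1/2.\<close>
  have "((p powr r + q powr r) / 2) powr (1 / r)
      \<le> ((p powr r) powr (1 / r) + (q powr r) powr (1 / r)) / 2"
    using convex_onD[OF powr_convex_closed[OF r(2)], of "1/2" "p powr r" "q powr r"]
    by (simp add: field_simps)
  also have "\<dots> = 1 / 2"
    using assms by (simp add: powr_powr)
  finally have "(((p powr r + q powr r) / 2) powr (1 / r)) powr r \<le> (1 / 2) powr r"
    using assms by (intro powr_mono2) auto
  then have "(p powr r + q powr r) / 2 \<le> (1 / 2) powr r"
    using assms by (simp add: powr_powr)
  also have "(1 / 2 :: real) powr r = 2 powr (- r)"
    by (simp add: powr_divide powr_minus_divide)
  finally have "p powr r + q powr r \<le> 2 powr (- r) * 2 powr 1"
    by simp
  also have "\<dots> = k powr r"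
    unfolding k powr_add[symmetric] powr_powr using assms by (simp add: algebra_simps)
  finally have 1: "p powr r + q powr r \<le> k powr r" .
  have 2: "(p * \<xi> + q * \<eta>) powr r \<le> p powr r * \<xi> powr r + q powr r * \<eta> powr r"
    if "0 \<le> \<xi>" "0 \<le> \<eta>" for \<xi> \<eta>
    using powr_sum_le[of r "p * \<xi>" "q * \<eta>"] that assms r by (simp add: powr_mult)
  show ?thesis
    by (rule that[of "p powr r" "q powr r"]) (use 1 2 k_def in auto)
qed

section \<open>Concave functions in \<open>class_P\<close> and their homogeneous extensions\<close>

lemma class_P_nonneg: "\<rho> \<in> class_P \<Longrightarrow> 0 \<le> u \<Longrightarrow> 0 \<le> \<rho> u"
  by (auto simp: class_P_def)

lemma class_P_pos: "\<rho> \<in> class_P \<Longrightarrow> 0 < u \<Longrightarrow> 0 < \<rho> u"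
  unfolding class_P_def by (smt (verit) mem_Collect_eq)

lemma class_P_mono: "\<rho> \<in> class_P \<Longrightarrow> 0 \<le> u \<Longrightarrow> u \<le> v \<Longrightarrow> \<rho> u \<le> \<rho> v"
  by (auto simp: class_P_def mono_on_def)

text \<open>Concavity between 0 and u, where \<rho> vanishes at 0. Equivalently \<rho>(u)/u is
  nonincreasing, which is what makes \<open>two_var\<close> monotone in its first argument.\<close>

lemma class_P_scale:
  assumes "\<rho> \<in> class_P" "0 \<le> u" "0 \<le> t" "t \<le> 1"
  shows "t * \<rho> u \<le> \<rho> (t * u)"
proof -
  have "concave_on {0..} \<rho>" "\<rho> 0 = 0" using assms by (auto simp: class_P_def)
  from concave_onD[OF this(1), of t 0 u] this(2) show ?thesis
    using assms by simp
qed

lemma two_var_nonneg: "\<rho> \<in> class_P \<Longrightarrow> 0 \<le> t \<Longrightarrow> 0 \<le> two_var \<rho> s t"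
  by (auto simp: two_var_def class_P_nonneg)

lemma two_var_pos: "\<rho> \<in> class_P \<Longrightarrow> 0 < s \<Longrightarrow> 0 < t \<Longrightarrow> 0 < two_var \<rho> s t"
  by (auto simp: two_var_def class_P_pos)

lemma two_var_zero: "\<rho> \<in> class_P \<Longrightarrow> s = 0 \<or> t = 0 \<Longrightarrow> two_var \<rho> s t = 0"
  by (auto simp: two_var_def class_P_def)

lemma two_var_homogeneous: "0 < k \<Longrightarrow> two_var \<rho> (k * s) (k * t) = k * two_var \<rho> s t"
  by (auto simp: two_var_def zero_less_mult_iff)

lemma two_var_mono:
  assumes P: "\<rho> \<in> class_P" and "0 \<le> s" "s \<le> s'" "0 \<le> t" "t \<le> t'"
  shows "two_var \<rho> s t \<le> two_var \<rho> s' t'"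
proof (cases "s > 0")
  case True
  have "(s / s') * \<rho> (t / s) \<le> \<rho> ((s / s') * (t / s))"
    using True assms by (intro class_P_scale[OF P]) auto
  also have "\<dots> \<le> \<rho> (t' / s')"
    using True assms by (intro class_P_mono[OF P]) (auto simp: divide_right_mono)
  finally have "s' * ((s / s') * \<rho> (t / s)) \<le> s' * \<rho> (t' / s')"
    using True assms by (intro mult_left_mono) auto
  then show ?thesis using True assms by (simp add: two_var_def)
next
  case False
  then show ?thesis using assms by (simp add: two_var_def class_P_nonneg[OF P])
qed

text \<open>A supporting line w \<mapsto> \<alpha> + \<beta> w of the concave \<rho> at u = b/a
  becomes, by homogeneity, a plane above \<open>two_var\<close> that touches it along the ray
  through (a,b). Positivity of a and b puts u in the interior, where a finite slope exists.\<close>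

lemma two_var_tangent:
  assumes P: "\<rho> \<in> class_P" and "0 < a" "0 < b"
  obtains \<alpha> \<beta> where "0 \<le> \<alpha>" "0 \<le> \<beta>" "two_var \<rho> a b = \<alpha> * a + \<beta> * b"
    "\<And>s t. 0 \<le> s \<Longrightarrow> 0 \<le> t \<Longrightarrow> two_var \<rho> s t \<le> \<alpha> * s + \<beta> * t"
proof -
  define u where "u = b / a"
  have u: "u > 0" using assms by (simp add: u_def)
  have conc: "concave_on {0..} \<rho>" and z: "\<rho> 0 = 0" using P by (auto simp: class_P_def)
  have slope: "(\<rho> w - \<rho> u) / (w - u) \<le> (\<rho> u - \<rho> v) / (u - v)"
    if "0 \<le> v" "v < u" "u < w" for v w
  proof -
    define t where "t = (u - v) / (w - v)"
    have t: "0 \<le> t" "t \<le> 1" using that by (auto simp: t_def)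
    have wv: "w - v > 0" using that by simp
    have tm: "t * (w - v) = u - v" using wv by (simp add: t_def)
    then have "(1 - t) * v + t * w = u" by (simp add: algebra_simps)
    then have "(1 - t) * \<rho> v + t * \<rho> w \<le> \<rho> u"
      using concave_onD[OF conc, of t v w] t that by simp
    then have "((1 - t) * \<rho> v + t * \<rho> w) * (w - v) \<le> \<rho> u * (w - v)"
      using wv by (intro mult_right_mono) auto
    moreover have "((1 - t) * \<rho> v + t * \<rho> w) * (w - v)
        = (w - v) * \<rho> v + (t * (w - v)) * (\<rho> w - \<rho> v)"
      by (simp add: algebra_simps)
    ultimately have "(w - v) * \<rho> v + (u - v) * (\<rho> w - \<rho> v) \<le> \<rho> u * (w - v)"
      by (simp only: tm)
    then have "(\<rho> w - \<rho> u) * (u - v) \<le> (\<rho> u - \<rho> v) * (w - u)"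
      by (simp add: algebra_simps)
    then show ?thesis using that by (simp add: field_simps)
  qed
  \<comment> \<open>The right derivative at u: chords to the right of u flatten as w grows, so their
    supremum is the limit. The chord from 0 to u bounds them all.\<close>
  define \<beta> where "\<beta> = (SUP w\<in>{u<..}. (\<rho> w - \<rho> u) / (w - u))"
  have bdd: "bdd_above ((\<lambda>w. (\<rho> w - \<rho> u) / (w - u)) ` {u<..})"
    using slope[of 0] u by (intro bdd_aboveI2[where M = "(\<rho> u - \<rho> 0) / (u - 0)"]) auto
  have up: "(\<rho> w - \<rho> u) / (w - u) \<le> \<beta>" if "u < w" for w
    unfolding \<beta>_def using bdd that by (intro cSUP_upper) auto
  have lo: "\<beta> \<le> (\<rho> u - \<rho> v) / (u - v)" if "0 \<le> v" "v < u" for v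
    unfolding \<beta>_def using slope that by (intro cSUP_least) auto
  have "0 \<le> (\<rho> (u + 1) - \<rho> u) / ((u + 1) - u)"
    using class_P_mono[OF P, of u "u + 1"] u by simp
  also have "\<dots> \<le> \<beta>" by (rule up) simp
  finally have \<beta>0: "0 \<le> \<beta>" .
  \<comment> \<open>The intercept of the supporting line at 0, nonnegative because the line lies
    above \<rho> 0 = 0.\<close>
  define \<alpha> where "\<alpha> = \<rho> u - \<beta> * u"
  have \<alpha>0: "0 \<le> \<alpha>" using lo[of 0] u z by (simp add: \<alpha>_def field_simps)
  have line: "\<rho> w \<le> \<alpha> + \<beta> * w" if "0 \<le> w" for w
  proof (cases w u rule: linorder_cases)
    case less
    then show ?thesis using lo[of w] that by (simp add: \<alpha>_def field_simps)
  next
    case greater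
    then show ?thesis using up[of w] that by (simp add: \<alpha>_def field_simps)
  qed (simp add: \<alpha>_def)
  show ?thesis
  proof (rule that[OF \<alpha>0 \<beta>0])
    show "two_var \<rho> a b = \<alpha> * a + \<beta> * b"
      using assms by (simp add: two_var_def \<alpha>_def u_def field_simps)
    show "two_var \<rho> s t \<le> \<alpha> * s + \<beta> * t" if "0 \<le> s" "0 \<le> t" for s t
    proof (cases "s > 0")
      case True
      have "s * \<rho> (t / s) \<le> s * (\<alpha> + \<beta> * (t / s))"
        using True that by (intro mult_left_mono line) auto
      also have "\<dots> = \<alpha> * s + \<beta> * t"
        using True by (simp add: distrib_left)
      finally show ?thesis using True by (simp add: two_var_def)
    next
      case False
      then show ?thesis using that \<beta>0 \<alpha>0 by (simp add: two_var_def)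
    qed
  qed
qed

subsection \<open>Rearrangements\<close>

lemma antimono_borel_measurable:
  fixes f :: "real \<Rightarrow> ennreal"
  assumes "antimono f"
  shows "f \<in> borel_measurable borel"
proof (rule borel_measurableI_greater)
  fix y
  have "is_interval {x. y < f x}"
    unfolding is_interval_1 using antimonoD[OF assms] by (auto intro: less_le_trans)
  then show "{x \<in> space borel. y < f x} \<in> sets borel"
    using real_interval_borel_measurable by simp
qed

lemma borel_in_L0: "f \<in> borel_measurable borel \<Longrightarrow> f \<in> L0 I"
  unfolding L0_def
  by (intro measurable_restrict_space1 measurable_completion) simp

lemma antimono_in_L0:
  assumes "antimono h"
  shows "(\<lambda>t. enn2real (h t)) \<in> L0 I"
  using antimono_borel_measurable[OF assms] by (intro borel_in_L0) simp

section \<open>The underlying intervals and their null sets\<close>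

definition std_interval :: "real set \<Rightarrow> bool" where
  "std_interval I \<longleftrightarrow> I = {0<..<1} \<or> I = {0<..}"

lemma std_interval_sets: "std_interval I \<Longrightarrow> I \<in> sets lebesgue"
  by (auto simp: std_interval_def)

lemma std_interval_pos: "std_interval I \<Longrightarrow> t \<in> I \<Longrightarrow> 0 < t"
  by (auto simp: std_interval_def)

lemma std_interval_down: "std_interval I \<Longrightarrow> t \<in> I \<Longrightarrow> 0 < s \<Longrightarrow> s \<le> t \<Longrightarrow> s \<in> I"
  by (auto simp: std_interval_def)

lemma std_interval_half: "std_interval I \<Longrightarrow> t \<in> I \<Longrightarrow> t / 2 \<in> I"
  by (auto simp: std_interval_def)

lemma std_interval_nonempty: "std_interval I \<Longrightarrow> 1 / 2 \<in> I"
  by (auto simp: std_interval_def)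

lemma std_interval_ex_greater: "std_interval I \<Longrightarrow> t \<in> I \<Longrightarrow> \<exists>u\<in>I. t < u"
  unfolding std_interval_def
  by (elim disjE) (auto intro: bexI[of _ "(t + 1) / 2"] bexI[of _ "t + 1"])

lemma std_interval_Ioc: "std_interval I \<Longrightarrow> t \<in> I \<Longrightarrow> {0<..t} \<subseteq> I"
  using std_interval_down by auto

lemma emeasure_std_interval:
  assumes "std_interval I" "A \<subseteq> I"
  shows "emeasure (lebesgue_on I) A = emeasure lebesgue A"
  using assms std_interval_sets by (simp add: emeasure_restrict_space)

lemma std_interval_Ioo:
  assumes "std_interval I" "ennreal D \<le> emeasure (lebesgue_on I) I"
  shows "{0<..<D} \<subseteq> I"
  using assms emeasure_std_interval[of I I] by (auto simp: std_interval_def)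

lemma AE_lebesgue_on_ex:
  assumes "std_interval I" "AE t in lebesgue_on I. P t" "a < b" "{a<..<b} \<subseteq> I"
  obtains t where "a < t" "t < b" "P t"
proof -
  have "AE t in lebesgue. t \<in> I \<longrightarrow> P t"
    using assms std_interval_sets by (simp add: AE_restrict_space_iff)
  then obtain N where N: "{t. \<not> (t \<in> I \<longrightarrow> P t)} \<subseteq> N" "emeasure lebesgue N = 0" "N \<in> sets lebesgue"
    by (auto elim!: AE_E)
  have "\<not> {a<..<b} \<subseteq> N"
  proof
    assume "{a<..<b} \<subseteq> N"
    then have "emeasure lebesgue {a<..<b} \<le> emeasure lebesgue N"
      using N by (intro emeasure_mono) auto
    then show False using N \<open>a < b\<close> by simp
  qed
  then obtain t where t: "t \<in> {a<..<b}" "t \<notin> N" by blast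
  then have "P t" using N(1) assms(4) by blast
  then show ?thesis using t that by auto
qed

section \<open>Distribution functions and rearrangements\<close>

lemma level_set_sets:
  assumes "x \<in> L0 I"
  shows "{s \<in> I. \<bar>x s\<bar> > c} \<in> sets (lebesgue_on I)" "{s \<in> I. \<bar>x s\<bar> \<ge> c} \<in> sets (lebesgue_on I)"
proof -
  have [measurable]: "x \<in> borel_measurable (lebesgue_on I)" using assms by (simp add: L0_def)
  have "{s \<in> space (lebesgue_on I). \<bar>x s\<bar> > c} \<in> sets (lebesgue_on I)"
    "{s \<in> space (lebesgue_on I). \<bar>x s\<bar> \<ge> c} \<in> sets (lebesgue_on I)" by measurable
  then show "{s \<in> I. \<bar>x s\<bar> > c} \<in> sets (lebesgue_on I)" "{s \<in> I. \<bar>x s\<bar> \<ge> c} \<in> sets (lebesgue_on I)"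
    by simp_all
qed

text \<open>The infimum defining x*(t) is attained, because the distribution function is right
  continuous: {|x| > c} is the increasing union of the sets {|x| > c + 1/(n+1)}. Estimates of x*
  thereby turn into estimates of measures. The \<epsilon> in the first half covers c = 0, which
  \<open>rearr\<close> excludes from its levels.\<close>

lemma rearr_le_iff:
  assumes x: "x \<in> L0 I" and c: "0 \<le> c"
  shows "rearr I x t \<le> ennreal c \<longleftrightarrow> emeasure (lebesgue_on I) {s \<in> I. \<bar>x s\<bar> > c} \<le> ennreal t"
proof
  assume le: "emeasure (lebesgue_on I) {s \<in> I. \<bar>x s\<bar> > c} \<le> ennreal t"
  show "rearr I x t \<le> ennreal c"
  proof (rule ennreal_le_epsilon)
    fix e :: real assume e: "0 < e"
    have "emeasure (lebesgue_on I) {s \<in> I. \<bar>x s\<bar> > c + e}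
        \<le> emeasure (lebesgue_on I) {s \<in> I. \<bar>x s\<bar> > c}"
      using e by (intro emeasure_mono level_set_sets x) auto
    then have "rearr I x t \<le> ennreal (c + e)"
      unfolding rearr_def using le e c by (intro Inf_lower CollectI exI[of _ "c + e"]) auto
    then show "rearr I x t \<le> ennreal c + ennreal e"
      using e c by (simp add: ennreal_plus)
  qed
next
  assume le: "rearr I x t \<le> ennreal c"
  define A where "A n = {s \<in> I. \<bar>x s\<bar> > c + 1 / real (Suc n)}" for n
  have A_le: "emeasure (lebesgue_on I) (A n) \<le> ennreal t" for n
  proof -
    have "ennreal c < ennreal (c + 1 / real (Suc n))"
      using c by (intro ennreal_lessI add_nonneg_pos) auto
    then have "rearr I x t < ennreal (c + 1 / real (Suc n))"
      using le by (rule le_less_trans[rotated])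
    then obtain c' where c': "0 < c'" "ennreal c' < ennreal (c + 1 / real (Suc n))"
      "emeasure (lebesgue_on I) {s \<in> I. \<bar>x s\<bar> > c'} \<le> ennreal t"
      unfolding rearr_def Inf_less_iff by auto
    have "c' < c + 1 / real (Suc n)"
      using c'(1,2) by (simp add: ennreal_less_iff)
    then have "emeasure (lebesgue_on I) (A n) \<le> emeasure (lebesgue_on I) {s \<in> I. \<bar>x s\<bar> > c'}"
      unfolding A_def by (intro emeasure_mono level_set_sets x) auto
    then show ?thesis using c'(3) by (rule order_trans)
  qed
  have "incseq A"
  proof (intro incseq_SucI subsetI)
    fix n s assume "s \<in> A n"
    moreover have "1 / real (Suc (Suc n)) \<le> 1 / real (Suc n)"
      by (intro divide_left_mono) auto
    ultimately show "s \<in> A (Suc n)"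
      by (auto simp: A_def simp del: of_nat_Suc)
  qed
  moreover have "(\<Union>n. A n) = {s \<in> I. \<bar>x s\<bar> > c}"
  proof (intro equalityI subsetI)
    fix s assume "s \<in> {s \<in> I. \<bar>x s\<bar> > c}"
    then have s: "s \<in> I" "\<bar>x s\<bar> - c > 0" by auto
    then obtain n where "inverse (real (Suc n)) < \<bar>x s\<bar> - c"
      using reals_Archimedean by blast
    then show "s \<in> (\<Union>n. A n)"
      using s by (auto simp: A_def inverse_eq_divide intro!: exI[of _ n])
  next
    fix s assume "s \<in> (\<Union>n. A n)"
    then obtain n where n: "s \<in> I" "\<bar>x s\<bar> > c + 1 / real (Suc n)" by (auto simp: A_def)
    have "1 / real (Suc n) > 0" by simp
    then show "s \<in> {s \<in> I. \<bar>x s\<bar> > c}" using n by (smt (verit) mem_Collect_eq)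
  qed
  moreover have "range A \<subseteq> sets (lebesgue_on I)"
    unfolding A_def using level_set_sets[OF x] by auto
  ultimately have "emeasure (lebesgue_on I) {s \<in> I. \<bar>x s\<bar> > c} = (SUP n. emeasure (lebesgue_on I) (A n))"
    by (simp add: SUP_emeasure_incseq)
  also have "\<dots> \<le> ennreal t" using A_le by (rule SUP_least)
  finally show "emeasure (lebesgue_on I) {s \<in> I. \<bar>x s\<bar> > c} \<le> ennreal t" .
qed

lemma rearr_antimono: "antimono (rearr I x)"
proof (rule antimonoI)
  fix s t :: real assume "s \<le> t"
  then have "ennreal s \<le> ennreal t" by (rule ennreal_leI)
  then show "rearr I x t \<le> rearr I x s"
    unfolding rearr_def by (intro Inf_superset_mono) (blast intro: order_trans)
qed

text \<open>Up to a null set, {|x| > c} lies in the union of {|x0| > a} and {|x1| > b}, each of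
  measure at most t/2. It serves two purposes: sums of two elements of a symmetrization, and
  functions bounded by \<open>two_var\<close>.\<close>

lemma rearr_le_two:
  assumes L: "x \<in> L0 I" "x0 \<in> L0 I" "x1 \<in> L0 I" and t: "0 \<le> t" "std_interval I"
    and a: "0 \<le> a" "rearr I x0 (t / 2) \<le> ennreal a"
    and b: "0 \<le> b" "rearr I x1 (t / 2) \<le> ennreal b"
    and c: "0 \<le> c"
    and ae: "AE s in lebesgue_on I. \<bar>x0 s\<bar> \<le> a \<longrightarrow> \<bar>x1 s\<bar> \<le> b \<longrightarrow> \<bar>x s\<bar> \<le> c"
  shows "rearr I x t \<le> ennreal c"
  unfolding rearr_le_iff[OF L(1) c]
proof -
  let ?M = "lebesgue_on I"
  let ?A = "{s \<in> I. \<bar>x0 s\<bar> > a}" and ?B = "{s \<in> I. \<bar>x1 s\<bar> > b}"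
  have "emeasure ?M {s \<in> I. \<bar>x s\<bar> > c} \<le> emeasure ?M (?A \<union> ?B)"
  proof (rule emeasure_mono_AE)
    show "AE s in ?M. s \<in> {s \<in> I. \<bar>x s\<bar> > c} \<longrightarrow> s \<in> ?A \<union> ?B"
      using ae by eventually_elim auto
  qed (intro sets.Un level_set_sets L)
  also have "\<dots> \<le> emeasure ?M ?A + emeasure ?M ?B"
    by (intro emeasure_subadditive level_set_sets L)
  also have "\<dots> \<le> ennreal (t / 2) + ennreal (t / 2)"
    using a b rearr_le_iff L by (intro add_mono) auto
  also have "\<dots> = ennreal t"
    using t by (simp flip: ennreal_plus)
  finally show "emeasure ?M {s \<in> I. \<bar>x s\<bar> > c} \<le> ennreal t" .
qed

lemma rearr_mono:
  assumes L: "x \<in> L0 I" "y \<in> L0 I" and ae: "AE s in lebesgue_on I. \<bar>x s\<bar> \<le> \<bar>y s\<bar>"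
  shows "rearr I x t \<le> rearr I y t"
proof (cases "rearr I y t")
  case (real c)
  then have "emeasure (lebesgue_on I) {s \<in> I. \<bar>y s\<bar> > c} \<le> ennreal t"
    using rearr_le_iff[OF L(2)] by (metis order_refl)
  moreover have "emeasure (lebesgue_on I) {s \<in> I. \<bar>x s\<bar> > c} \<le> emeasure (lebesgue_on I) {s \<in> I. \<bar>y s\<bar> > c}"
  proof (rule emeasure_mono_AE)
    show "AE s in lebesgue_on I. s \<in> {s \<in> I. \<bar>x s\<bar> > c} \<longrightarrow> s \<in> {s \<in> I. \<bar>y s\<bar> > c}"
      using ae by eventually_elim auto
  qed (intro level_set_sets L)
  ultimately show ?thesis
    using rearr_le_iff[OF L(1), of c] real by auto
qed simp

lemma rearr_cong_AE:
  assumes "x \<in> L0 I" "y \<in> L0 I" "AE s in lebesgue_on I. x s = y s"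
  shows "rearr I x t = rearr I y t"
  using assms by (intro antisym rearr_mono) (auto elim: eventually_mono)

lemma L0_cmult: "x \<in> L0 I \<Longrightarrow> (\<lambda>t. c * x t) \<in> L0 I"
  by (simp add: L0_def)

lemma L0_add: "x \<in> L0 I \<Longrightarrow> y \<in> L0 I \<Longrightarrow> (\<lambda>t. x t + y t) \<in> L0 I"
  by (simp add: L0_def)

lemma rearr_cmult_le:
  assumes L: "x \<in> L0 I" and "k \<noteq> 0"
  shows "rearr I (\<lambda>s. k * x s) t \<le> ennreal \<bar>k\<bar> * rearr I x t"
proof (cases "rearr I x t")
  case (real c)
  then have "emeasure (lebesgue_on I) {s \<in> I. \<bar>x s\<bar> > c} \<le> ennreal t"
    using rearr_le_iff[OF L] by (metis order_refl)
  moreover have "{s \<in> I. \<bar>k * x s\<bar> > \<bar>k\<bar> * c} = {s \<in> I. \<bar>x s\<bar> > c}"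
    using assms by (auto simp: abs_mult)
  ultimately show ?thesis
    using rearr_le_iff[OF L0_cmult[OF L, of k], of "\<bar>k\<bar> * c"] real by (simp add: ennreal_mult)
next
  case top
  then show ?thesis using assms by (simp add: ennreal_mult_top)
qed

lemma rearr_zero: "rearr I (\<lambda>s. 0) t = 0"
proof -
  have "rearr I (\<lambda>s. 0) t \<le> ennreal 0"
    by (subst rearr_le_iff) (auto simp: L0_def)
  then show ?thesis by simp
qed

lemma rearr_cmult:
  assumes L: "x \<in> L0 I"
  shows "rearr I (\<lambda>s. k * x s) t = ennreal \<bar>k\<bar> * rearr I x t"
proof (cases "k = 0")
  case False
  \<comment> \<open>The reverse inequality is the first one applied to k x with the factor
    1/k.\<close>
  have "ennreal \<bar>k\<bar> * rearr I x t \<le> ennreal \<bar>k\<bar> * (ennreal \<bar>1 / k\<bar> * rearr I (\<lambda>s. k * x s) t)"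
    using rearr_cmult_le[OF L0_cmult[OF L, of k], of "1 / k" t] False
    by (intro mult_left_mono) auto
  also have "\<dots> = rearr I (\<lambda>s. k * x s) t"
    using False by (simp add: mult.assoc[symmetric] ennreal_mult[symmetric])
  finally show ?thesis using rearr_cmult_le[OF L False, of t] by (rule antisym[rotated])
qed (simp add: rearr_zero)

text \<open>x*(t) = 0 means that {|x| > 0} has measure at most t. An a.e. statement supplies such t
  arbitrarily close to 0.\<close>

lemma rearr_zero_imp:
  assumes I: "std_interval I" and x: "x \<in> L0 I" and ae: "AE t in lebesgue_on I. rearr I x t = 0"
  shows "AE t in lebesgue_on I. x t = 0"
proof -
  let ?m = "emeasure (lebesgue_on I) {s \<in> I. \<bar>x s\<bar> > 0}"
  have "?m \<le> 0"
  proof (rule ennreal_le_epsilon)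
    fix e :: real assume e: "0 < e"
    \<comment> \<open>The cap 1/2 keeps (0,d) inside both possible intervals.\<close>
    define d where "d = min e (1/2)"
    have "{0<..<d} \<subseteq> I"
      using std_interval_down[OF I std_interval_nonempty[OF I]] by (auto simp: d_def)
    then obtain t where t: "0 < t" "t < d" "rearr I x t = 0"
      using AE_lebesgue_on_ex[OF I ae, of 0 d] e by (auto simp: d_def)
    then have "?m \<le> ennreal t"
      using rearr_le_iff[OF x, of 0 t] by simp
    also have "\<dots> \<le> 0 + ennreal e" using t by (simp add: d_def ennreal_leI)
    finally show "?m \<le> 0 + ennreal e" .
  qed
  then have "{s \<in> I. \<bar>x s\<bar> > 0} \<in> null_sets (lebesgue_on I)"
    using level_set_sets[OF x, of 0] by auto
  then show ?thesis
    by (rule AE_I') auto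
qed

text \<open>A decreasing function is finite to the right of any point where it is finite, and
  finiteness a.e. provides such points near 0. The conclusion covers all t > 0, including those
  outside I.\<close>

lemma antimono_finite:
  assumes I: "std_interval I" and h: "antimono h" and ae: "AE t in lebesgue_on I. h t < \<infinity>" and "0 < t"
  shows "h t < (\<infinity> :: ennreal)"
proof -
  define d where "d = min t (1/2)"
  have "{0<..<d} \<subseteq> I"
    using std_interval_down[OF I std_interval_nonempty[OF I]] by (auto simp: d_def)
  then obtain s where s: "0 < s" "s < d" "h s < \<infinity>"
    using AE_lebesgue_on_ex[OF I ae, of 0 d] \<open>0 < t\<close> by (auto simp: d_def)
  then have "h t \<le> h s" by (intro antimonoD[OF h]) (auto simp: d_def)
  then show ?thesis using s(3) by (rule le_less_trans)
qed

text \<open>The equality holds at every continuity point of h, and a monotone function has only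
  countably many discontinuities. This puts any decreasing function belonging to E, such as x* or
  H_r^* x, into \<open>decreasing_cone\<close>, so that the dilation constant applies to it.\<close>

lemma rearr_of_antimono:
  assumes I: "std_interval I" and h: "antimono h" and fin: "\<And>t. 0 < t \<Longrightarrow> h t < \<infinity>"
  shows "AE t in lebesgue_on I. rearr I (\<lambda>t. enn2real (h t)) t = h t"
proof -
  define g where "g t = enn2real (h t)" for t
  have g: "ennreal (g t) = h t" if "0 < t" for t
    using fin[OF that] by (simp add: g_def)
  have gL: "g \<in> L0 I" unfolding g_def by (rule antimono_in_L0[OF h])
  have g0: "0 \<le> g t" for t by (simp add: g_def)
  have ganti: "g t \<le> g s" if "0 < s" "s \<le> t" for s t
    unfolding g_def using antimonoD[OF h that(2)] fin[OF that(1)] by (simp add: enn2real_mono)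
  have "mono_on {0<..} (\<lambda>t. - g t)"
    by (intro mono_onI) (use ganti in auto)
  then have cnt: "countable {a\<in>{0<..}. \<not> isCont (\<lambda>t. - g t) a}"
    by (intro mono_on_ctble_discont_open) auto
  have "AE t in lebesgue. t \<notin> {a\<in>{0<..}. \<not> isCont (\<lambda>t. - g t) a}"
    by (intro AE_not_in null_sets_completionI countable_imp_null_set_lborel cnt)
  then have "AE t in lebesgue_on I. t \<notin> {a\<in>{0<..}. \<not> isCont (\<lambda>t. - g t) a}"
    using std_interval_sets[OF I] by (subst AE_restrict_space_iff) (auto elim: eventually_mono)
  moreover have "AE t in lebesgue_on I. t \<in> I" by (rule AE_I2) simp
  ultimately have "AE t in lebesgue_on I. rearr I g t = h t"
  proof eventually_elim
    case (elim t)
    have t: "0 < t" using std_interval_pos[OF I] elim by auto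
    then have "isCont (\<lambda>t. - (- g t)) t" using elim by (intro continuous_minus[of _ "\<lambda>t. - g t"]) blast
    then have cont: "isCont g t" by simp
    have "rearr I g t \<le> ennreal (g t)"
    proof (subst rearr_le_iff[OF gL g0])
      have "{s \<in> I. \<bar>g s\<bar> > g t} \<subseteq> {0<..t}"
      proof
        fix s assume "s \<in> {s \<in> I. \<bar>g s\<bar> > g t}"
        then have "s \<in> I" "g s > g t" using g0 by auto
        then show "s \<in> {0<..t}"
          using ganti[OF t, of s] std_interval_pos[OF I] by force
      qed
      then have "emeasure (lebesgue_on I) {s \<in> I. \<bar>g s\<bar> > g t} \<le> emeasure (lebesgue_on I) {0<..t}"
        using std_interval_Ioc[OF I] elim std_interval_sets[OF I]
        by (intro emeasure_mono) (auto simp: sets_restrict_space_iff)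
      also have "\<dots> = ennreal t"
        using std_interval_Ioc[OF I] elim t by (simp add: emeasure_std_interval[OF I])
      finally show "emeasure (lebesgue_on I) {s \<in> I. \<bar>g s\<bar> > g t} \<le> ennreal t" .
    qed
    moreover have "ennreal (g t) \<le> rearr I g t"
    proof (rule ccontr)
      assume "\<not> ennreal (g t) \<le> rearr I g t"
      then have lt: "rearr I g t < ennreal (g t)" by simp
      then obtain c where c: "0 \<le> c" "rearr I g t = ennreal c"
        by (cases "rearr I g t") auto
      then have "c < g t" using lt by (simp add: ennreal_less_iff)
      have le: "emeasure (lebesgue_on I) {s \<in> I. \<bar>g s\<bar> > c} \<le> ennreal t"
        using rearr_le_iff[OF gL c(1)] c(2) by (metis order_refl)
      \<comment> \<open>Continuity keeps g above c slightly to the right of t, so {g > c} contains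
        an interval (0,s] with s > t, against its measure being at most t.\<close>
      have "eventually (\<lambda>s. g s > c) (at t)"
        using cont \<open>c < g t\<close> unfolding isCont_def by (rule order_tendstoD)
      then obtain d where d: "d > 0" "\<And>s. s \<noteq> t \<Longrightarrow> dist s t < d \<Longrightarrow> g s > c"
        unfolding eventually_at by auto
      obtain u where u: "u \<in> I" "t < u" using std_interval_ex_greater[OF I] elim by blast
      \<comment> \<open>The minimum with u keeps s inside I when t is close to the right end of
        (0,1).\<close>
      define s where "s = min u (t + d / 2)"
      have s: "t < s" "s \<in> I" "g s > c"
        using u d std_interval_down[OF I u(1)] t by (auto simp: s_def dist_real_def min_def)
      have "{0<..s} \<subseteq> {s \<in> I. \<bar>g s\<bar> > c}"
      proof
        fix v assume "v \<in> {0<..s}"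
        then have v: "v \<in> I" "g s \<le> g v" using std_interval_Ioc[OF I s(2)] ganti by auto
        then show "v \<in> {s \<in> I. \<bar>g s\<bar> > c}" using s g0[of v] by auto
      qed
      then have "emeasure (lebesgue_on I) {0<..s} \<le> emeasure (lebesgue_on I) {s \<in> I. \<bar>g s\<bar> > c}"
        by (intro emeasure_mono level_set_sets gL)
      also have "emeasure (lebesgue_on I) {0<..s} = ennreal s"
        using std_interval_Ioc[OF I s(2)] s t by (simp add: emeasure_std_interval[OF I])
      finally have "ennreal s \<le> ennreal t" using le by (rule order_trans)
      then show False using s t by (simp add: ennreal_le_iff)
    qed
    ultimately show ?case using g[OF t] by simp
  qed
  then show ?thesis by (simp add: g_def[abs_def])
qed

subsection \<open>Symmetrizations\<close>

text \<open>The part of the ideal space structure that passes to symmetrizations, so that the same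
  lemmas on Calderon-Lozanovskii spaces serve for E and F and for their symmetrizations.\<close>

definition solid_space :: "real set \<Rightarrow> fspace \<Rightarrow> bool" where
  "solid_space I E \<longleftrightarrow>
     quasi_normed_space I E \<and>
     (\<forall>y\<in>elems E. \<forall>x\<in>L0 I. (AE t in lebesgue_on I. \<bar>x t\<bar> \<le> \<bar>y t\<bar>) \<longrightarrow>
        x \<in> elems E \<and> qnorm E x \<le> qnorm E y)"

lemma quasi_Banach_ideal_space_solid: "quasi_Banach_ideal_space I E \<Longrightarrow> solid_space I E"
  by (simp add: quasi_Banach_ideal_space_def quasi_normed_ideal_space_def solid_space_def)

context
  fixes I E
  assumes E: "solid_space I E"
begin

lemma solid_L0: "x \<in> elems E \<Longrightarrow> x \<in> L0 I"
  using E unfolding solid_space_def quasi_normed_space_def linear_subspace_def by blast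

lemma solid_zero: "(\<lambda>t. 0) \<in> elems E"
  using E unfolding solid_space_def quasi_normed_space_def linear_subspace_def by blast

lemma solid_add: "x \<in> elems E \<Longrightarrow> y \<in> elems E \<Longrightarrow> (\<lambda>t. x t + y t) \<in> elems E"
  using E unfolding solid_space_def quasi_normed_space_def linear_subspace_def by blast

lemma solid_cmult: "x \<in> elems E \<Longrightarrow> (\<lambda>t. c * x t) \<in> elems E"
  using E unfolding solid_space_def quasi_normed_space_def linear_subspace_def by blast

lemma solid_norm_nonneg: "x \<in> elems E \<Longrightarrow> 0 \<le> qnorm E x"
  using E unfolding solid_space_def quasi_normed_space_def quasi_norm_def by blast

lemma solid_norm_zero_iff:
  "x \<in> elems E \<Longrightarrow> qnorm E x = 0 \<longleftrightarrow> (AE t in lebesgue_on I. x t = 0)"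
  using E unfolding solid_space_def quasi_normed_space_def quasi_norm_def by blast

lemma solid_norm_cmult: "x \<in> elems E \<Longrightarrow> qnorm E (\<lambda>t. c * x t) = \<bar>c\<bar> * qnorm E x"
  using E unfolding solid_space_def quasi_normed_space_def quasi_norm_def by blast

lemma solid_quasi_triangle:
  obtains K where "1 \<le> K"
    "\<And>x y. x \<in> elems E \<Longrightarrow> y \<in> elems E \<Longrightarrow> qnorm E (\<lambda>t. x t + y t) \<le> K * (qnorm E x + qnorm E y)"
  using E unfolding solid_space_def quasi_normed_space_def quasi_norm_def by blast

lemma solid_ideal:
  assumes "y \<in> elems E" "x \<in> L0 I" "AE t in lebesgue_on I. \<bar>x t\<bar> \<le> \<bar>y t\<bar>"
  shows "x \<in> elems E" "qnorm E x \<le> qnorm E y"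
  using E assms unfolding solid_space_def by blast+

lemma solid_cong:
  assumes "y \<in> elems E" "x \<in> L0 I" "AE t in lebesgue_on I. x t = y t"
  shows "x \<in> elems E" "qnorm E x = qnorm E y"
proof -
  show x: "x \<in> elems E"
    by (rule solid_ideal(1)[OF assms(1,2)]) (use assms(3) in \<open>auto elim: eventually_mono\<close>)
  show "qnorm E x = qnorm E y"
    using assms(3)
    by (intro antisym solid_ideal(2) x assms solid_L0) (auto elim: eventually_mono)
qed

end

text \<open>Each condition f x \<le> A g x is closed in A, so the greatest lower bound of the
  admissible constants is admissible. This lets the estimates use the best constants themselves
  instead of approximations. Where g x = 0, any admissible constant already shows f x \<le>
  0.\<close>

lemma best_constant_mem:
  fixes f g :: "'a \<Rightarrow> real" and a :: real
  assumes S: "S = {A. a \<le> A \<and> (\<forall>x\<in>X. P x \<and> f x \<le> A * g x)}" and ne: "S \<noteq> {}"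
    and g: "\<And>x. x \<in> X \<Longrightarrow> 0 \<le> g x"
  shows "Inf S \<in> S"
proof -
  have mem: "A \<in> S \<longleftrightarrow> a \<le> A \<and> (\<forall>x\<in>X. P x \<and> f x \<le> A * g x)" for A
    by (simp add: S)
  obtain A where A: "A \<in> S" using ne by blast
  have "f x \<le> Inf S * g x" if x: "x \<in> X" for x
  proof (cases "g x = 0")
    case True
    then show ?thesis using A x unfolding mem by force
  next
    case False
    then have pos: "0 < g x" using g[OF x] by simp
    have "f x / g x \<le> Inf S"
      by (rule cInf_greatest[OF ne]) (use x pos in \<open>auto simp: mem pos_divide_le_eq\<close>)
    then show ?thesis using pos by (simp add: pos_divide_le_eq)
  qed
  moreover have "a \<le> Inf S"
    by (rule cInf_greatest[OF ne]) (simp add: mem)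
  moreover have "\<forall>x\<in>X. P x" using A unfolding mem by blast
  ultimately show ?thesis unfolding mem by blast
qed

lemma dilation_const_mem:
  assumes "solid_space I E" "dilation_bounded I E"
  shows "dilation_const I E \<in> dilation_consts I E"
  unfolding dilation_const_def
  using assms
  by (intro best_constant_mem[OF dilation_consts_def])
    (auto simp: dilation_bounded_def decreasing_cone_def solid_norm_nonneg)

lemma Hstar_norm_mem:
  assumes "solid_space I E" "Hstar_bounded I r E"
  shows "Hstar_norm I r E \<in> Hstar_consts I r E"
  unfolding Hstar_norm_def
  using assms
  by (intro best_constant_mem[OF Hstar_consts_def])
    (auto simp: Hstar_bounded_def solid_norm_nonneg)

lemma dilation_antimono:
  assumes I: "std_interval I" and E: "solid_space I E" and A: "A \<in> dilation_consts I E"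
    and h: "antimono h" and mem: "ext_mem I h E"
  shows "(\<lambda>t. enn2real (h (t / 2))) \<in> elems E"
    "qnorm E (\<lambda>t. enn2real (h (t / 2))) \<le> A * ext_norm E h"
proof -
  have fin: "h t < \<infinity>" if "0 < t" for t
    using antimono_finite[OF I h _ that] mem by (simp add: ext_mem_def)
  have "AE t in lebesgue_on I. 0 < t"
    by (rule AE_I2) (use std_interval_pos[OF I] in auto)
  moreover have "AE t in lebesgue_on I. rearr I (\<lambda>t. enn2real (h t)) t = h t"
    by (rule rearr_of_antimono[OF I h fin])
  ultimately have "AE t in lebesgue_on I.
      0 \<le> enn2real (h t) \<and> ennreal (enn2real (h t)) = rearr I (\<lambda>t. enn2real (h t)) t"
    by eventually_elim (use fin in auto)
  then have "(\<lambda>t. enn2real (h t)) \<in> decreasing_cone I E"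
    using mem by (simp add: decreasing_cone_def ext_mem_def)
  then have "dilation2 (\<lambda>t. enn2real (h t)) \<in> elems E \<and>
      qnorm E (dilation2 (\<lambda>t. enn2real (h t))) \<le> A * qnorm E (\<lambda>t. enn2real (h t))"
    using A by (auto simp: dilation_consts_def)
  then show "(\<lambda>t. enn2real (h (t / 2))) \<in> elems E"
    "qnorm E (\<lambda>t. enn2real (h (t / 2))) \<le> A * ext_norm E h"
    by (auto simp: dilation2_def[abs_def] ext_norm_def)
qed

lemma ext_mem_ideal:
  assumes E: "solid_space I E" and y: "y \<in> elems E" and h: "antimono h"
    and le: "AE t in lebesgue_on I. h t \<le> ennreal (y t)"
  shows "ext_mem I h E" "ext_norm E h \<le> qnorm E y"
proof -
  have 1: "AE t in lebesgue_on I. \<bar>enn2real (h t)\<bar> \<le> \<bar>y t\<bar>"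
    using le
  proof eventually_elim
    case (elim t)
    then have "enn2real (h t) \<le> enn2real (ennreal (y t))" by (intro enn2real_mono) auto
    \<comment> \<open>For negative y t the majorant \<open>ennreal (y t)\<close> is 0, which forces
      h t = 0.\<close>
    then show ?case by (cases "0 \<le> y t") (auto simp: ennreal_neg)
  qed
  have "AE t in lebesgue_on I. h t < \<infinity>"
    using le by eventually_elim (auto intro: le_less_trans)
  then show "ext_mem I h E" "ext_norm E h \<le> qnorm E y"
    using solid_ideal[OF E y antimono_in_L0[OF h] 1] by (auto simp: ext_mem_def ext_norm_def)
qed

lemma ennreal_enn2real_rearr:
  assumes "std_interval I" "ext_mem I (rearr I x) E" "0 < t"
  shows "ennreal (enn2real (rearr I x t)) = rearr I x t"
  using antimono_finite[OF assms(1) rearr_antimono _ assms(3)] assms(2)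
  by (auto simp: ext_mem_def)

section \<open>Symmetrizations as solid quasi-normed spaces\<close>

lemma elems_symmetrization:
  "x \<in> elems (symmetrization I E) \<longleftrightarrow> x \<in> L0 I \<and> ext_mem I (rearr I x) E"
  by (simp add: symmetrization_def)

lemma qnorm_symmetrization: "qnorm (symmetrization I E) x = ext_norm E (rearr I x)"
  by (simp add: symmetrization_def)

lemma symmetrization_ideal:
  assumes I: "std_interval I" and E: "solid_space I E"
    and y: "y \<in> elems (symmetrization I E)" and x: "x \<in> L0 I"
    and le: "AE t in lebesgue_on I. \<bar>x t\<bar> \<le> \<bar>y t\<bar>"
  shows "x \<in> elems (symmetrization I E)"
    "qnorm (symmetrization I E) x \<le> qnorm (symmetrization I E) y"
proof -
  have yL: "y \<in> L0 I" and mem: "ext_mem I (rearr I y) E"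
    using y by (auto simp: elems_symmetrization)
  have "rearr I x t \<le> ennreal (enn2real (rearr I y t))" if "0 < t" for t
    using rearr_mono[OF x yL le, of t] ennreal_enn2real_rearr[OF I mem that] by simp
  then have "AE t in lebesgue_on I. rearr I x t \<le> ennreal (enn2real (rearr I y t))"
    using std_interval_pos[OF I] by (intro AE_I2) auto
  from ext_mem_ideal[OF E _ rearr_antimono this]
  show "x \<in> elems (symmetrization I E)"
    "qnorm (symmetrization I E) x \<le> qnorm (symmetrization I E) y"
    using x mem by (auto simp: elems_symmetrization qnorm_symmetrization ext_mem_def ext_norm_def)
qed

lemma symmetrization_zero_iff:
  assumes I: "std_interval I" and E: "solid_space I E" and x: "x \<in> elems (symmetrization I E)"
  shows "qnorm (symmetrization I E) x = 0 \<longleftrightarrow> (AE t in lebesgue_on I. x t = 0)"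
proof
  have xL: "x \<in> L0 I" and mem: "ext_mem I (rearr I x) E"
    using x by (auto simp: elems_symmetrization)
  { assume "qnorm (symmetrization I E) x = 0"
    then have "AE t in lebesgue_on I. enn2real (rearr I x t) = 0"
      using solid_norm_zero_iff[OF E] mem by (auto simp: qnorm_symmetrization ext_mem_def ext_norm_def)
    moreover have "AE t in lebesgue_on I. rearr I x t < \<infinity>" using mem by (simp add: ext_mem_def)
    ultimately have "AE t in lebesgue_on I. rearr I x t = 0"
      by eventually_elim (auto simp: enn2real_eq_0_iff)
    then show "AE t in lebesgue_on I. x t = 0" by (rule rearr_zero_imp[OF I xL]) }
  assume "AE t in lebesgue_on I. x t = 0"
  then have "rearr I x t = rearr I (\<lambda>t. 0) t" for t
    using solid_L0[OF E solid_zero[OF E]] by (intro rearr_cong_AE xL) auto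
  then show "qnorm (symmetrization I E) x = 0"
    using solid_norm_zero_iff[OF E solid_zero[OF E]]
    by (simp add: qnorm_symmetrization ext_norm_def rearr_zero)
qed

text \<open>The rearrangement of x + y at t is at most x*(t/2) + y*(t/2). The dilation contributes A
  and the quasi-triangle inequality of E contributes K.\<close>

lemma symmetrization_add:
  assumes I: "std_interval I" and E: "solid_space I E" and A: "A \<in> dilation_consts I E"
    and x: "x \<in> elems (symmetrization I E)" and y: "y \<in> elems (symmetrization I E)"
    and K: "\<And>x y. x \<in> elems E \<Longrightarrow> y \<in> elems E \<Longrightarrow> qnorm E (\<lambda>t. x t + y t) \<le> K * (qnorm E x + qnorm E y)"
    and K1: "1 \<le> K"
  shows "(\<lambda>t. x t + y t) \<in> elems (symmetrization I E)"
    "qnorm (symmetrization I E) (\<lambda>t. x t + y t)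
      \<le> (K * A) * (qnorm (symmetrization I E) x + qnorm (symmetrization I E) y)"
proof -
  have L: "x \<in> L0 I" "y \<in> L0 I" and mem: "ext_mem I (rearr I x) E" "ext_mem I (rearr I y) E"
    using x y by (auto simp: elems_symmetrization)
  define u where "u t = enn2real (rearr I x (t / 2))" for t
  define v where "v t = enn2real (rearr I y (t / 2))" for t
  have u: "u \<in> elems E" "qnorm E u \<le> A * ext_norm E (rearr I x)"
    unfolding u_def using dilation_antimono[OF I E A rearr_antimono mem(1)] by auto
  have v: "v \<in> elems E" "qnorm E v \<le> A * ext_norm E (rearr I y)"
    unfolding v_def using dilation_antimono[OF I E A rearr_antimono mem(2)] by auto
  have "rearr I (\<lambda>t. x t + y t) t \<le> ennreal (u t + v t)" if "t \<in> I" for t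
  proof (rule rearr_le_two[OF L0_add[OF L] L _ I])
    have t: "0 < t" using std_interval_pos[OF I that] .
    show "rearr I x (t / 2) \<le> ennreal (u t)" "rearr I y (t / 2) \<le> ennreal (v t)"
      using ennreal_enn2real_rearr[OF I mem(1), of "t / 2"] ennreal_enn2real_rearr[OF I mem(2), of "t / 2"] t
      by (auto simp: u_def v_def)
    show "AE s in lebesgue_on I. \<bar>x s\<bar> \<le> u t \<longrightarrow> \<bar>y s\<bar> \<le> v t \<longrightarrow> \<bar>x s + y s\<bar> \<le> u t + v t"
      by (rule AE_I2) auto
  qed (use std_interval_pos[OF I that] in \<open>auto simp: u_def v_def\<close>)
  then have "AE t in lebesgue_on I. rearr I (\<lambda>t. x t + y t) t \<le> ennreal (u t + v t)"
    by (intro AE_I2) auto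
  note sum = ext_mem_ideal[OF E solid_add[OF E u(1) v(1)] rearr_antimono this]
  show "(\<lambda>t. x t + y t) \<in> elems (symmetrization I E)"
    using sum L0_add[OF L] by (simp add: elems_symmetrization)
  have "ext_norm E (rearr I (\<lambda>t. x t + y t)) \<le> K * (qnorm E u + qnorm E v)"
    using sum(2) K[OF u(1) v(1)] by simp
  also have "\<dots> \<le> K * (A * ext_norm E (rearr I x) + A * ext_norm E (rearr I y))"
    using u(2) v(2) K1 by (intro mult_left_mono add_mono) auto
  finally show "qnorm (symmetrization I E) (\<lambda>t. x t + y t)
      \<le> (K * A) * (qnorm (symmetrization I E) x + qnorm (symmetrization I E) y)"
    by (simp add: qnorm_symmetrization algebra_simps)
qed

lemma symmetrization_cmult:
  assumes I: "std_interval I" and E: "solid_space I E" and x: "x \<in> elems (symmetrization I E)"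
  shows "(\<lambda>t. c * x t) \<in> elems (symmetrization I E)"
    "qnorm (symmetrization I E) (\<lambda>t. c * x t) = \<bar>c\<bar> * qnorm (symmetrization I E) x"
proof -
  have L: "x \<in> L0 I" and fin: "AE t in lebesgue_on I. rearr I x t < \<infinity>"
    and mem: "(\<lambda>t. enn2real (rearr I x t)) \<in> elems E"
    using x by (auto simp: elems_symmetrization ext_mem_def)
  have eq: "enn2real (rearr I (\<lambda>s. c * x s) t) = \<bar>c\<bar> * enn2real (rearr I x t)" for t
    by (simp add: rearr_cmult[OF L] enn2real_mult)
  have "AE t in lebesgue_on I. rearr I (\<lambda>s. c * x s) t < \<infinity>"
    using fin by eventually_elim (simp add: rearr_cmult[OF L] ennreal_mult_less_top)
  then show "(\<lambda>t. c * x t) \<in> elems (symmetrization I E)"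
    "qnorm (symmetrization I E) (\<lambda>t. c * x t) = \<bar>c\<bar> * qnorm (symmetrization I E) x"
    using solid_cmult[OF E mem, of "\<bar>c\<bar>"] solid_norm_cmult[OF E mem, of "\<bar>c\<bar>"] L0_cmult[OF L]
    by (simp_all add: elems_symmetrization qnorm_symmetrization ext_mem_def ext_norm_def eq)
qed

lemma symmetrization_solid:
  assumes I: "std_interval I" and E: "solid_space I E" and d: "dilation_bounded I E"
  shows "solid_space I (symmetrization I E)"
proof -
  let ?S = "symmetrization I E"
  obtain A where A: "A \<in> dilation_consts I E" using d by (auto simp: dilation_bounded_def)
  obtain K where K: "1 \<le> K"
    "\<And>x y. x \<in> elems E \<Longrightarrow> y \<in> elems E \<Longrightarrow> qnorm E (\<lambda>t. x t + y t) \<le> K * (qnorm E x + qnorm E y)"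
    using solid_quasi_triangle[OF E] by metis
  note add = symmetrization_add[OF I E A _ _ K(2) K(1)]
  note ideal = symmetrization_ideal[OF I E]
  have KA: "1 \<le> K * A" using K(1) A mult_mono[of 1 K 1 A] by (auto simp: dilation_consts_def)
  have zero: "(\<lambda>t. 0) \<in> elems ?S"
    using solid_zero[OF E] solid_L0[OF E solid_zero[OF E]]
    by (simp add: elems_symmetrization ext_mem_def rearr_zero)
  have cong: "y \<in> elems ?S" "qnorm ?S x = qnorm ?S y"
    if x: "x \<in> elems ?S" and y: "y \<in> L0 I" and ae: "AE t in lebesgue_on I. x t = y t" for x y
  proof -
    have le: "AE t in lebesgue_on I. \<bar>y t\<bar> \<le> \<bar>x t\<bar>" "AE t in lebesgue_on I. \<bar>x t\<bar> \<le> \<bar>y t\<bar>"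
      using ae by (auto elim: eventually_mono)
    show y': "y \<in> elems ?S" using ideal(1)[OF x y le(1)] .
    show "qnorm ?S x = qnorm ?S y"
      using ideal(2)[OF x y le(1)] ideal(2)[OF y' _ le(2)] x by (auto simp: elems_symmetrization)
  qed
  have "linear_subspace I (elems ?S)"
    unfolding linear_subspace_def
  proof (intro conjI ballI allI impI)
    show "elems ?S \<subseteq> L0 I" by (auto simp: elems_symmetrization)
  qed (use zero add(1) symmetrization_cmult(1)[OF I E] cong(1) in blast)+
  moreover have "quasi_norm I (elems ?S) (qnorm ?S)"
    unfolding quasi_norm_def
  proof (intro conjI)
    show "\<forall>x\<in>elems ?S. 0 \<le> qnorm ?S x"
      using solid_norm_nonneg[OF E]
      by (auto simp: elems_symmetrization qnorm_symmetrization ext_mem_def ext_norm_def)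
    show "\<forall>x\<in>elems ?S. qnorm ?S x = 0 \<longleftrightarrow> (AE t in lebesgue_on I. x t = 0)"
      using symmetrization_zero_iff[OF I E] by blast
    show "\<forall>x\<in>elems ?S. \<forall>c. qnorm ?S (\<lambda>t. c * x t) = \<bar>c\<bar> * qnorm ?S x"
      using symmetrization_cmult(2)[OF I E] by blast
    show "\<exists>K\<ge>1. \<forall>x\<in>elems ?S. \<forall>y\<in>elems ?S. qnorm ?S (\<lambda>t. x t + y t) \<le> K * (qnorm ?S x + qnorm ?S y)"
      using add(2) KA by blast
    show "\<forall>x\<in>elems ?S. \<forall>y\<in>elems ?S. (AE t in lebesgue_on I. x t = y t) \<longrightarrow> qnorm ?S x = qnorm ?S y"
      using cong(2) by (auto simp: elems_symmetrization)
  qed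
  ultimately show ?thesis
    unfolding solid_space_def quasi_normed_space_def using ideal by blast
qed

subsection \<open>Calderon--Lozanovskii spaces\<close>

text \<open>Calderon-Lozanovskii norms are infima of \<open>CL_bounds\<close>. With this lemma it
  suffices to map admissible constants to admissible constants, with no choice of nearly optimal
  ones.\<close>

lemma Inf_mult_le:
  fixes A B :: "real set"
  assumes k: "0 \<le> k" and A: "A \<noteq> {}" and AB: "\<And>c. c \<in> A \<Longrightarrow> k * c \<in> B" and B: "\<And>b. b \<in> B \<Longrightarrow> 0 \<le> b"
  shows "Inf B \<le> k * Inf A"
proof -
  have bdd: "bdd_below B" using B by (rule bdd_belowI)
  have le: "Inf B \<le> k * c" if "c \<in> A" for c
    using AB[OF that] bdd by (rule cInf_lower)
  show ?thesis
  proof (cases "k = 0")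
    case True
    then show ?thesis using le A by auto
  next
    case False
    then have pos: "0 < k" using k by simp
    have "Inf B / k \<le> Inf A"
      by (rule cInf_greatest[OF A]) (use le pos in \<open>auto simp: pos_divide_le_eq mult.commute\<close>)
    then show ?thesis using pos by (simp add: pos_divide_le_eq mult.commute)
  qed
qed

lemma Inf_add_le:
  fixes A B C :: "real set"
  assumes k: "0 < k" and A: "A \<noteq> {}" and B: "B \<noteq> {}"
    and ABC: "\<And>c d. c \<in> A \<Longrightarrow> d \<in> B \<Longrightarrow> k * (c + d) \<in> C" and C: "\<And>b. b \<in> C \<Longrightarrow> 0 \<le> b"
  shows "Inf C \<le> k * (Inf A + Inf B)"
proof -
  have bdd: "bdd_below C" using C by (rule bdd_belowI)
  have le: "Inf C / k \<le> c + d" if "c \<in> A" "d \<in> B" for c d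
    using cInf_lower[OF ABC[OF that] bdd] k by (simp add: pos_divide_le_eq mult.commute)
  have "Inf C / k - Inf A \<le> Inf B"
  proof (rule cInf_greatest[OF B])
    fix d assume d: "d \<in> B"
    have "Inf C / k - d \<le> Inf A"
      by (rule cInf_greatest[OF A]) (use le d in \<open>auto simp: algebra_simps\<close>)
    then show "Inf C / k - Inf A \<le> d" by simp
  qed
  then show ?thesis using k by (simp add: pos_divide_le_eq mult.commute field_simps)
qed

lemma elems_CL: "x \<in> elems (Calderon_Lozanovskii I \<rho> E F) \<longleftrightarrow> x \<in> L0 I \<and> CL_bounds I \<rho> E F x \<noteq> {}"
  by (simp add: Calderon_Lozanovskii_def)

lemma qnorm_CL: "qnorm (Calderon_Lozanovskii I \<rho> E F) x = Inf (CL_bounds I \<rho> E F x)"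
  by (simp add: Calderon_Lozanovskii_def)

lemma CL_bounds_pos: "c \<in> CL_bounds I \<rho> E F x \<Longrightarrow> 0 < c"
  by (simp add: CL_bounds_def)

lemma CL_bounds_nonneg: "c \<in> CL_bounds I \<rho> E F x \<Longrightarrow> 0 \<le> c"
  using CL_bounds_pos by force

lemma CL_bounds_mono:
  assumes "AE t in lebesgue_on I. \<bar>x t\<bar> \<le> \<bar>y t\<bar>"
  shows "CL_bounds I \<rho> E F y \<subseteq> CL_bounds I \<rho> E F x"
proof
  fix c assume "c \<in> CL_bounds I \<rho> E F y"
  then obtain x0 x1 where c: "0 < c" "x0 \<in> elems E" "x1 \<in> elems F" "qnorm E x0 \<le> 1" "qnorm F x1 \<le> 1"
    and ae: "AE t in lebesgue_on I. \<bar>y t\<bar> \<le> c * two_var \<rho> \<bar>x0 t\<bar> \<bar>x1 t\<bar>"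
    by (auto simp: CL_bounds_def)
  have "AE t in lebesgue_on I. \<bar>x t\<bar> \<le> c * two_var \<rho> \<bar>x0 t\<bar> \<bar>x1 t\<bar>"
    using ae assms by eventually_elim (rule order_trans)
  then show "c \<in> CL_bounds I \<rho> E F x"
    using c unfolding CL_bounds_def by blast
qed

lemma CL_bounds_cong:
  assumes "AE t in lebesgue_on I. x t = y t"
  shows "CL_bounds I \<rho> E F x = CL_bounds I \<rho> E F y"
  by (intro antisym CL_bounds_mono) (use assms in \<open>auto elim: eventually_mono\<close>)

lemma CL_bounds_cmult:
  assumes "k \<noteq> 0" "c \<in> CL_bounds I \<rho> E F x"
  shows "\<bar>k\<bar> * c \<in> CL_bounds I \<rho> E F (\<lambda>t. k * x t)"
proof -
  obtain x0 x1 where c: "0 < c" "x0 \<in> elems E" "x1 \<in> elems F" "qnorm E x0 \<le> 1" "qnorm F x1 \<le> 1"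
    and ae: "AE t in lebesgue_on I. \<bar>x t\<bar> \<le> c * two_var \<rho> \<bar>x0 t\<bar> \<bar>x1 t\<bar>"
    using assms by (auto simp: CL_bounds_def)
  have "AE t in lebesgue_on I. \<bar>k * x t\<bar> \<le> (\<bar>k\<bar> * c) * two_var \<rho> \<bar>x0 t\<bar> \<bar>x1 t\<bar>"
    using ae by eventually_elim (auto simp: abs_mult mult.assoc intro: mult_left_mono)
  moreover have "0 < \<bar>k\<bar> * c" using assms c by simp
  ultimately show ?thesis
    using c unfolding CL_bounds_def by blast
qed

lemma qnorm_CL_nonneg:
  assumes "x \<in> elems (Calderon_Lozanovskii I \<rho> E F)"
  shows "0 \<le> qnorm (Calderon_Lozanovskii I \<rho> E F) x"
  using assms unfolding elems_CL qnorm_CL by (intro cInf_greatest CL_bounds_nonneg) auto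

lemma solid_sum_abs:
  assumes G: "solid_space I G"
    and K: "\<And>x y. x \<in> elems G \<Longrightarrow> y \<in> elems G \<Longrightarrow> qnorm G (\<lambda>t. x t + y t) \<le> K * (qnorm G x + qnorm G y)"
    and K1: "0 \<le> K" "K \<le> L"
    and x: "x \<in> elems G" "qnorm G x \<le> 1" and y: "y \<in> elems G" "qnorm G y \<le> 1"
  shows "(\<lambda>t. \<bar>x t\<bar> + \<bar>y t\<bar>) \<in> elems G" "qnorm G (\<lambda>t. \<bar>x t\<bar> + \<bar>y t\<bar>) \<le> 2 * L"
proof -
  have abs: "(\<lambda>t. \<bar>z t\<bar>) \<in> elems G" "qnorm G (\<lambda>t. \<bar>z t\<bar>) \<le> 1" if "z \<in> elems G" "qnorm G z \<le> 1" for z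
  proof -
    have "(\<lambda>t. \<bar>z t\<bar>) \<in> L0 I" using solid_L0[OF G that(1)] by (simp add: L0_def)
    from solid_ideal[OF G that(1) this] that(2)
    show "(\<lambda>t. \<bar>z t\<bar>) \<in> elems G" "qnorm G (\<lambda>t. \<bar>z t\<bar>) \<le> 1" by auto
  qed
  show "(\<lambda>t. \<bar>x t\<bar> + \<bar>y t\<bar>) \<in> elems G"
    by (intro solid_add[OF G] abs x y)
  have "qnorm G (\<lambda>t. \<bar>x t\<bar> + \<bar>y t\<bar>) \<le> K * (qnorm G (\<lambda>t. \<bar>x t\<bar>) + qnorm G (\<lambda>t. \<bar>y t\<bar>))"
    by (intro K abs x y)
  also have "\<dots> \<le> K * (1 + 1)"
    by (intro mult_left_mono add_mono abs x y K1)
  finally show "qnorm G (\<lambda>t. \<bar>x t\<bar> + \<bar>y t\<bar>) \<le> 2 * L" using K1 by simp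
qed

context
  fixes I \<rho> E F
  assumes P: "\<rho> \<in> class_P" and E: "solid_space I E" and F: "solid_space I F"
begin

text \<open>Homogeneity of \<open>two_var\<close>: dividing both majorants by the same N moves them
  into the unit balls and costs the factor N. A common N for E and F is the reason why the final
  constants contain a maximum.\<close>

lemma CL_boundsI:
  assumes c: "0 < c" and N: "0 < N" and x0: "x0 \<in> elems E" "qnorm E x0 \<le> N"
    and x1: "x1 \<in> elems F" "qnorm F x1 \<le> N"
    and ae: "AE t in lebesgue_on I. \<bar>x t\<bar> \<le> c * two_var \<rho> \<bar>x0 t\<bar> \<bar>x1 t\<bar>"
  shows "c * N \<in> CL_bounds I \<rho> E F x"
proof -
  have norms: "qnorm E (\<lambda>t. (1 / N) * x0 t) \<le> 1" "qnorm F (\<lambda>t. (1 / N) * x1 t) \<le> 1"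
    using N x0 x1
    unfolding solid_norm_cmult[OF E x0(1)] solid_norm_cmult[OF F x1(1)] by simp_all
  have "two_var \<rho> \<bar>x0 t\<bar> \<bar>x1 t\<bar> = N * two_var \<rho> \<bar>(1 / N) * x0 t\<bar> \<bar>(1 / N) * x1 t\<bar>" for t
    using N two_var_homogeneous[of N \<rho> "\<bar>(1 / N) * x0 t\<bar>" "\<bar>(1 / N) * x1 t\<bar>"]
    by (simp add: abs_mult)
  then have "AE t in lebesgue_on I. \<bar>x t\<bar> \<le> (c * N) * two_var \<rho> \<bar>(1 / N) * x0 t\<bar> \<bar>(1 / N) * x1 t\<bar>"
    using ae by (simp add: mult.assoc)
  moreover have "0 < c * N" using c N by simp
  ultimately show ?thesis
    unfolding CL_bounds_def
    using norms solid_cmult[OF E x0(1), of "1 / N"] solid_cmult[OF F x1(1), of "1 / N"] by blast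
qed

lemma CL_bounds_zero:
  assumes "0 < c" "AE t in lebesgue_on I. x t = 0"
  shows "c \<in> CL_bounds I \<rho> E F x"
proof -
  have "qnorm E (\<lambda>t. 0) = 0" "qnorm F (\<lambda>t. 0) = 0"
    using solid_norm_zero_iff[OF E solid_zero[OF E]] solid_norm_zero_iff[OF F solid_zero[OF F]] by auto
  moreover have "AE t in lebesgue_on I. \<bar>x t\<bar> \<le> c * two_var \<rho> \<bar>0\<bar> \<bar>0\<bar>"
    using assms(2) by eventually_elim (simp add: two_var_zero[OF P])
  ultimately have "c * 1 \<in> CL_bounds I \<rho> E F x"
    using assms(1) solid_zero[OF E] solid_zero[OF F]
    by (intro CL_boundsI[where ?x0.0 = "\<lambda>t. 0" and ?x1.0 = "\<lambda>t. 0"]) auto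
  then show ?thesis by simp
qed

text \<open>By monotonicity both \<open>two_var\<close> terms are dominated by the value at the pair
  |x0| + |y0|, |x1| + |y1|. These sums have norm at most 2 L, where L is the larger of the
  quasi-triangle constants of E and F.\<close>

lemma CL_bounds_add:
  obtains K where "1 \<le> K"
    "\<And>c d x y. c \<in> CL_bounds I \<rho> E F x \<Longrightarrow> d \<in> CL_bounds I \<rho> E F y \<Longrightarrow>
      K * (c + d) \<in> CL_bounds I \<rho> E F (\<lambda>t. x t + y t)"
proof -
  obtain KE where KE: "1 \<le> KE"
    "\<And>x y. x \<in> elems E \<Longrightarrow> y \<in> elems E \<Longrightarrow> qnorm E (\<lambda>t. x t + y t) \<le> KE * (qnorm E x + qnorm E y)"
    using solid_quasi_triangle[OF E] by metis
  obtain KF where KF: "1 \<le> KF"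
    "\<And>x y. x \<in> elems F \<Longrightarrow> y \<in> elems F \<Longrightarrow> qnorm F (\<lambda>t. x t + y t) \<le> KF * (qnorm F x + qnorm F y)"
    using solid_quasi_triangle[OF F] by metis
  define L where "L = max KE KF"
  have L: "1 \<le> L" "KE \<le> L" "KF \<le> L" using KE(1) by (auto simp: L_def)
  show ?thesis
  proof (rule that[of "2 * L"])
    fix c d x y
    assume "c \<in> CL_bounds I \<rho> E F x" "d \<in> CL_bounds I \<rho> E F y"
    then obtain x0 x1 y0 y1 where c: "0 < c" "0 < d"
      and x: "x0 \<in> elems E" "qnorm E x0 \<le> 1" "x1 \<in> elems F" "qnorm F x1 \<le> 1"
      and y: "y0 \<in> elems E" "qnorm E y0 \<le> 1" "y1 \<in> elems F" "qnorm F y1 \<le> 1"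
      and ae: "AE t in lebesgue_on I. \<bar>x t\<bar> \<le> c * two_var \<rho> \<bar>x0 t\<bar> \<bar>x1 t\<bar>"
        "AE t in lebesgue_on I. \<bar>y t\<bar> \<le> d * two_var \<rho> \<bar>y0 t\<bar> \<bar>y1 t\<bar>"
      by (auto simp: CL_bounds_def)
    define u0 where "u0 t = \<bar>x0 t\<bar> + \<bar>y0 t\<bar>" for t
    define u1 where "u1 t = \<bar>x1 t\<bar> + \<bar>y1 t\<bar>" for t
    have "0 \<le> KE" "0 \<le> KF" using KE(1) KF(1) by auto
    note u0 = solid_sum_abs[OF E KE(2) this(1) L(2) x(1,2) y(1,2), folded u0_def]
      and u1 = solid_sum_abs[OF F KF(2) this(2) L(3) x(3,4) y(3,4), folded u1_def]
    have "AE t in lebesgue_on I. \<bar>x t + y t\<bar> \<le> (c + d) * two_var \<rho> \<bar>u0 t\<bar> \<bar>u1 t\<bar>"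
      using ae
    proof eventually_elim
      case (elim t)
      have "two_var \<rho> \<bar>x0 t\<bar> \<bar>x1 t\<bar> \<le> two_var \<rho> \<bar>u0 t\<bar> \<bar>u1 t\<bar>"
        "two_var \<rho> \<bar>y0 t\<bar> \<bar>y1 t\<bar> \<le> two_var \<rho> \<bar>u0 t\<bar> \<bar>u1 t\<bar>"
        by (rule two_var_mono[OF P]; simp add: u0_def u1_def)+
      then have "c * two_var \<rho> \<bar>x0 t\<bar> \<bar>x1 t\<bar> + d * two_var \<rho> \<bar>y0 t\<bar> \<bar>y1 t\<bar>
          \<le> c * two_var \<rho> \<bar>u0 t\<bar> \<bar>u1 t\<bar> + d * two_var \<rho> \<bar>u0 t\<bar> \<bar>u1 t\<bar>"
        using c by (intro add_mono mult_left_mono) auto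
      then show ?case
        using elim abs_triangle_ineq[of "x t" "y t"] unfolding distrib_right by linarith
    qed
    then have "(c + d) * (2 * L) \<in> CL_bounds I \<rho> E F (\<lambda>t. x t + y t)"
      using c L by (intro CL_boundsI[OF _ _ u0 u1]) auto
    then show "2 * L * (c + d) \<in> CL_bounds I \<rho> E F (\<lambda>t. x t + y t)"
      by (simp add: mult.commute)
  qed (use L in simp)
qed

lemma CL_cmult:
  assumes x: "x \<in> elems (Calderon_Lozanovskii I \<rho> E F)"
  shows "(\<lambda>t. k * x t) \<in> elems (Calderon_Lozanovskii I \<rho> E F)"
    "qnorm (Calderon_Lozanovskii I \<rho> E F) (\<lambda>t. k * x t) = \<bar>k\<bar> * qnorm (Calderon_Lozanovskii I \<rho> E F) x"
proof -
  let ?B = "CL_bounds I \<rho> E F"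
  have xL: "x \<in> L0 I" and ne: "?B x \<noteq> {}" using x by (auto simp: elems_CL)
  have "?B (\<lambda>t. k * x t) \<noteq> {} \<and> Inf (?B (\<lambda>t. k * x t)) = \<bar>k\<bar> * Inf (?B x)"
  proof (cases "k = 0")
    case True
    have all: "c \<in> ?B (\<lambda>t. k * x t)" if "0 < c" for c
      by (rule CL_bounds_zero[OF that]) (simp add: True)
    have "?B (\<lambda>t. k * x t) = {0<..}"
      using all CL_bounds_pos by blast
    then show ?thesis using True by simp
  next
    case False
    have sub: "c \<in> ?B x \<Longrightarrow> \<bar>k\<bar> * c \<in> ?B (\<lambda>t. k * x t)" for c
      by (rule CL_bounds_cmult[OF False])
    have ne': "?B (\<lambda>t. k * x t) \<noteq> {}" using ne sub by blast
    have inv: "\<bar>1 / k\<bar> * c \<in> ?B x" if "c \<in> ?B (\<lambda>t. k * x t)" for c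
    proof -
      have "1 / k \<noteq> 0" using False by simp
      from CL_bounds_cmult[OF this that] show ?thesis using False by simp
    qed
    have "Inf (?B x) \<le> \<bar>1 / k\<bar> * Inf (?B (\<lambda>t. k * x t))"
      by (rule Inf_mult_le[OF abs_ge_zero ne' inv CL_bounds_nonneg])
    then have "\<bar>k\<bar> * Inf (?B x) \<le> Inf (?B (\<lambda>t. k * x t))"
      using False by (simp add: pos_le_divide_eq mult.commute)
    moreover have "Inf (?B (\<lambda>t. k * x t)) \<le> \<bar>k\<bar> * Inf (?B x)"
      by (rule Inf_mult_le[OF abs_ge_zero ne sub CL_bounds_nonneg])
    ultimately show ?thesis using ne' by simp
  qed
  then show "(\<lambda>t. k * x t) \<in> elems (Calderon_Lozanovskii I \<rho> E F)"
    "qnorm (Calderon_Lozanovskii I \<rho> E F) (\<lambda>t. k * x t) = \<bar>k\<bar> * qnorm (Calderon_Lozanovskii I \<rho> E F) x"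
    using L0_cmult[OF xL] by (auto simp: elems_CL qnorm_CL)
qed

lemma CL_quasi_triangle:
  obtains K where "1 \<le> K"
    "\<And>x y. x \<in> elems (Calderon_Lozanovskii I \<rho> E F) \<Longrightarrow> y \<in> elems (Calderon_Lozanovskii I \<rho> E F) \<Longrightarrow>
      (\<lambda>t. x t + y t) \<in> elems (Calderon_Lozanovskii I \<rho> E F) \<and>
      qnorm (Calderon_Lozanovskii I \<rho> E F) (\<lambda>t. x t + y t)
        \<le> K * (qnorm (Calderon_Lozanovskii I \<rho> E F) x + qnorm (Calderon_Lozanovskii I \<rho> E F) y)"
proof -
  obtain K where K: "1 \<le> K"
    "\<And>c d x y. c \<in> CL_bounds I \<rho> E F x \<Longrightarrow> d \<in> CL_bounds I \<rho> E F y \<Longrightarrow>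
      K * (c + d) \<in> CL_bounds I \<rho> E F (\<lambda>t. x t + y t)"
    using CL_bounds_add by metis
  show ?thesis
  proof (rule that[OF K(1)])
    fix x y
    assume "x \<in> elems (Calderon_Lozanovskii I \<rho> E F)" "y \<in> elems (Calderon_Lozanovskii I \<rho> E F)"
    then have L: "x \<in> L0 I" "y \<in> L0 I" and ne: "CL_bounds I \<rho> E F x \<noteq> {}" "CL_bounds I \<rho> E F y \<noteq> {}"
      by (auto simp: elems_CL)
    have "CL_bounds I \<rho> E F (\<lambda>t. x t + y t) \<noteq> {}" using ne K(2) by blast
    moreover have "Inf (CL_bounds I \<rho> E F (\<lambda>t. x t + y t))
        \<le> K * (Inf (CL_bounds I \<rho> E F x) + Inf (CL_bounds I \<rho> E F y))"
      using K(1) by (intro Inf_add_le[OF _ ne K(2) CL_bounds_nonneg]) auto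
    ultimately show "(\<lambda>t. x t + y t) \<in> elems (Calderon_Lozanovskii I \<rho> E F) \<and>
      qnorm (Calderon_Lozanovskii I \<rho> E F) (\<lambda>t. x t + y t)
        \<le> K * (qnorm (Calderon_Lozanovskii I \<rho> E F) x + qnorm (Calderon_Lozanovskii I \<rho> E F) y)"
      using L0_add[OF L] by (auto simp: elems_CL qnorm_CL)
  qed
qed

lemma CL_linear_subspace: "linear_subspace I (elems (Calderon_Lozanovskii I \<rho> E F))"
  unfolding linear_subspace_def
proof (intro conjI ballI allI impI)
  show "elems (Calderon_Lozanovskii I \<rho> E F) \<subseteq> L0 I" by (auto simp: elems_CL)
  have "1 \<in> CL_bounds I \<rho> E F (\<lambda>t. 0)" by (rule CL_bounds_zero) auto
  then show "(\<lambda>t. 0) \<in> elems (Calderon_Lozanovskii I \<rho> E F)"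
    using solid_L0[OF E solid_zero[OF E]] by (auto simp: elems_CL)
  show "(\<lambda>t. x t + y t) \<in> elems (Calderon_Lozanovskii I \<rho> E F)"
    if "x \<in> elems (Calderon_Lozanovskii I \<rho> E F)" "y \<in> elems (Calderon_Lozanovskii I \<rho> E F)" for x y
    using CL_quasi_triangle that by metis
  show "(\<lambda>t. c * x t) \<in> elems (Calderon_Lozanovskii I \<rho> E F)"
    if "x \<in> elems (Calderon_Lozanovskii I \<rho> E F)" for x c
    using CL_cmult(1)[OF that] .
  show "y \<in> elems (Calderon_Lozanovskii I \<rho> E F)"
    if "x \<in> elems (Calderon_Lozanovskii I \<rho> E F)" "y \<in> L0 I" "AE t in lebesgue_on I. x t = y t" for x y
    using that CL_bounds_cong[OF that(3), of \<rho> E F] by (simp add: elems_CL)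
qed

lemma qnorm_CL_zero:
  assumes "AE t in lebesgue_on I. x t = 0"
  shows "qnorm (Calderon_Lozanovskii I \<rho> E F) x = 0"
proof -
  have "CL_bounds I \<rho> E F x = {0<..}"
    using CL_bounds_zero[OF _ assms] CL_bounds_pos by blast
  then show ?thesis by (simp add: qnorm_CL)
qed

end

subsection \<open>Calderon--Lozanovskii spaces of symmetrizations\<close>

lemma rearr_CL_le:
  assumes I: "std_interval I" and P: "\<rho> \<in> class_P" and x: "x \<in> L0 I" and c: "0 < c"
    and x0: "x0 \<in> elems (symmetrization I E)" and x1: "x1 \<in> elems (symmetrization I F)"
    and ae: "AE s in lebesgue_on I. \<bar>x s\<bar> \<le> c * two_var \<rho> \<bar>x0 s\<bar> \<bar>x1 s\<bar>"
    and t: "0 < t"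
    and a: "0 \<le> a" "rearr I x0 (t / 2) \<le> ennreal a" and b: "0 \<le> b" "rearr I x1 (t / 2) \<le> ennreal b"
  shows "rearr I x t \<le> ennreal (c * two_var \<rho> a b)"
proof (rule rearr_le_two[OF x _ _ _ I a b])
  show "AE s in lebesgue_on I. \<bar>x0 s\<bar> \<le> a \<longrightarrow> \<bar>x1 s\<bar> \<le> b \<longrightarrow> \<bar>x s\<bar> \<le> c * two_var \<rho> a b"
    using ae
  proof (eventually_elim, intro impI)
    fix s assume s: "\<bar>x s\<bar> \<le> c * two_var \<rho> \<bar>x0 s\<bar> \<bar>x1 s\<bar>" "\<bar>x0 s\<bar> \<le> a" "\<bar>x1 s\<bar> \<le> b"
    have "two_var \<rho> \<bar>x0 s\<bar> \<bar>x1 s\<bar> \<le> two_var \<rho> a b"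
      using s by (intro two_var_mono[OF P]) auto
    then have "c * two_var \<rho> \<bar>x0 s\<bar> \<bar>x1 s\<bar> \<le> c * two_var \<rho> a b"
      using c by simp
    then show "\<bar>x s\<bar> \<le> c * two_var \<rho> a b" using s by simp
  qed
qed (use x0 x1 t c two_var_nonneg[OF P b(1)] in \<open>auto simp: elems_symmetrization\<close>)

text \<open>Part (i) at the level of admissible constants: if x0 and x1 are majorants for x, their
  rearrangements dilated by 2 are majorants for x*, with norms at most A and B.\<close>

lemma CL_bounds_symmetrization:
  assumes I: "std_interval I" and P: "\<rho> \<in> class_P"
    and E: "solid_space I E" and F: "solid_space I F"
    and A: "A \<in> dilation_consts I E" and B: "B \<in> dilation_consts I F"
    and x: "x \<in> L0 I" and c: "c \<in> CL_bounds I \<rho> (symmetrization I E) (symmetrization I F) x"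
  shows "ext_mem I (rearr I x) (Calderon_Lozanovskii I \<rho> E F)"
    "max A B * c \<in> CL_bounds I \<rho> E F (\<lambda>t. enn2real (rearr I x t))"
proof -
  let ?M = "lebesgue_on I"
  obtain x0 x1 where c0: "0 < c" and x0: "x0 \<in> elems (symmetrization I E)" "qnorm (symmetrization I E) x0 \<le> 1"
    and x1: "x1 \<in> elems (symmetrization I F)" "qnorm (symmetrization I F) x1 \<le> 1"
    and ae: "AE t in ?M. \<bar>x t\<bar> \<le> c * two_var \<rho> \<bar>x0 t\<bar> \<bar>x1 t\<bar>"
    using c by (auto simp: CL_bounds_def)
  have mem: "ext_mem I (rearr I x0) E" "ext_mem I (rearr I x1) F"
    using x0 x1 by (auto simp: elems_symmetrization)
  define u where "u t = enn2real (rearr I x0 (t / 2))" for t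
  define v where "v t = enn2real (rearr I x1 (t / 2))" for t
  have A1: "1 \<le> A" "1 \<le> B" using A B by (auto simp: dilation_consts_def)
  have u: "u \<in> elems E" "qnorm E u \<le> A * ext_norm E (rearr I x0)"
    unfolding u_def by (rule dilation_antimono[OF I E A rearr_antimono mem(1)])+
  have v: "v \<in> elems F" "qnorm F v \<le> B * ext_norm F (rearr I x1)"
    unfolding v_def by (rule dilation_antimono[OF I F B rearr_antimono mem(2)])+
  have "A * ext_norm E (rearr I x0) \<le> A * 1"
    using x0 A1 by (intro mult_left_mono) (auto simp: qnorm_symmetrization)
  then have u': "qnorm E u \<le> max A B" using u(2) by simp
  have "B * ext_norm F (rearr I x1) \<le> B * 1"
    using x1 A1 by (intro mult_left_mono) (auto simp: qnorm_symmetrization)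
  then have v': "qnorm F v \<le> max A B" using v(2) by simp
  have le: "rearr I x t \<le> ennreal (c * two_var \<rho> (u t) (v t))" if "0 < t" for t
    using that ennreal_enn2real_rearr[OF I mem(1), of "t / 2"] ennreal_enn2real_rearr[OF I mem(2), of "t / 2"]
    by (intro rearr_CL_le[OF I P x c0 x0(1) x1(1) ae]) (auto simp: u_def v_def)
  have pos: "AE t in ?M. 0 < t"
    by (rule AE_I2) (use std_interval_pos[OF I] in auto)
  have "AE t in ?M. \<bar>enn2real (rearr I x t)\<bar> \<le> c * two_var \<rho> \<bar>u t\<bar> \<bar>v t\<bar>"
    using pos
  proof eventually_elim
    case (elim t)
    have uv: "0 \<le> u t" "0 \<le> v t" by (auto simp: u_def v_def)
    have "enn2real (rearr I x t) \<le> enn2real (ennreal (c * two_var \<rho> (u t) (v t)))"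
      by (rule enn2real_mono[OF le[OF elim]]) simp
    then show ?case using uv c0 two_var_nonneg[OF P uv(2)] by simp
  qed
  then have "c * max A B \<in> CL_bounds I \<rho> E F (\<lambda>t. enn2real (rearr I x t))"
    using A1 by (intro CL_boundsI[OF P E F c0 _ u(1) u' v(1) v']) auto
  then show bd: "max A B * c \<in> CL_bounds I \<rho> E F (\<lambda>t. enn2real (rearr I x t))"
    by (simp add: mult.commute)
  have "AE t in ?M. rearr I x t < \<infinity>"
    using pos by eventually_elim (auto intro: le_less_trans[OF le])
  then show "ext_mem I (rearr I x) (Calderon_Lozanovskii I \<rho> E F)"
    using bd antimono_in_L0[OF rearr_antimono, of I x] by (auto simp: ext_mem_def elems_CL)
qed

section \<open>Pointwise bounds on rearrangements, definiteness and nontriviality\<close>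

lemma rearr_ge_indicator:
  assumes I: "std_interval I" and mem: "ext_mem I (rearr I x) E" and t: "0 < t"
  shows "\<bar>enn2real (rearr I x t) * indicator {0<..t} s\<bar> \<le> \<bar>enn2real (rearr I x s)\<bar>"
proof (cases "s \<in> {0<..t}")
  case True
  then have "rearr I x t \<le> rearr I x s" by (intro antimonoD[OF rearr_antimono]) auto
  moreover have "rearr I x s < \<infinity>"
    by (rule antimono_finite[OF I rearr_antimono]) (use mem True in \<open>simp_all add: ext_mem_def\<close>)
  ultimately show ?thesis using True by (simp add: enn2real_mono)
qed simp

text \<open>Since x* dominates x*(t) times the indicator of (0,t], the norm of that indicator
  controls x*(t) uniformly over the unit ball.\<close>

lemma rearr_bounded_on_unit_ball:
  assumes I: "std_interval I" and E: "solid_space I E" and t: "t \<in> I"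
  obtains B where "0 \<le> B"
    "\<And>x. x \<in> elems (symmetrization I E) \<Longrightarrow> qnorm (symmetrization I E) x \<le> 1 \<Longrightarrow> rearr I x t \<le> ennreal B"
proof -
  define ind where "ind = (indicator {0<..t} :: real \<Rightarrow> real)"
  have t0: "0 < t" using std_interval_pos[OF I t] .
  have indL: "ind \<in> L0 I" unfolding ind_def by (rule borel_in_L0) simp
  \<comment> \<open>If the indicator is not in E, then x*(t) must vanish for every x in the
    symmetrization, so 0 is a valid bound.\<close>
  define B where "B = (if ind \<in> elems E then 1 / qnorm E ind else 0)"
  show ?thesis
  proof (rule that[of B])
    show "0 \<le> B" using solid_norm_nonneg[OF E] by (auto simp: B_def)
    fix x assume x: "x \<in> elems (symmetrization I E)" "qnorm (symmetrization I E) x \<le> 1"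
    then have mem: "ext_mem I (rearr I x) E" and mem': "(\<lambda>t. enn2real (rearr I x t)) \<in> elems E"
      and le1: "qnorm E (\<lambda>t. enn2real (rearr I x t)) \<le> 1"
      by (auto simp: elems_symmetrization qnorm_symmetrization ext_norm_def ext_mem_def)
    define a where "a = enn2real (rearr I x t)"
    have a: "rearr I x t = ennreal a" "0 \<le> a"
      using ennreal_enn2real_rearr[OF I mem t0] by (auto simp: a_def)
    have "AE s in lebesgue_on I. \<bar>a * ind s\<bar> \<le> \<bar>enn2real (rearr I x s)\<bar>"
      unfolding a_def ind_def using rearr_ge_indicator[OF I mem t0] by (intro AE_I2)
    note sol = solid_ideal[OF E mem' L0_cmult[OF indL] this]
    have "a \<le> B"
    proof (cases "a = 0")
      case True
      then show ?thesis using \<open>0 \<le> B\<close> by simp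
    next
      case False
      have eq: "(\<lambda>s. (1 / a) * (a * ind s)) = ind" using False by (auto simp: fun_eq_iff)
      have ind: "ind \<in> elems E" using solid_cmult[OF E sol(1), of "1 / a"] unfolding eq .
      have "qnorm E ind \<noteq> 0"
      proof
        assume "qnorm E ind = 0"
        then have "AE s in lebesgue_on I. ind s = 0" using solid_norm_zero_iff[OF E ind] by simp
        then obtain s where "0 < s" "s < t" "ind s = 0"
          by (rule AE_lebesgue_on_ex[OF I _ t0]) (use std_interval_Ioc[OF I t] in auto)
        then show False by (simp add: ind_def)
      qed
      then have "0 < qnorm E ind" using solid_norm_nonneg[OF E ind] by simp
      moreover have "a * qnorm E ind \<le> 1"
        using sol(2) le1 solid_norm_cmult[OF E ind, of a] a by simp
      ultimately show ?thesis using ind by (simp add: B_def pos_le_divide_eq)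
    qed
    then show "rearr I x t \<le> ennreal B" using a by (simp add: ennreal_leI)
  qed
qed

text \<open>The majorants x0, x1 vary with the admissible constant c, so one cannot let c tend to 0
  in the pointwise inequality for fixed majorants. On the side of rearrangements this works: x*(t)
  \<le> c \<rho>(a,b), where a and b bound all rearrangements from the unit balls at t/2 and are
  independent of c.\<close>

lemma CL_symmetrization_definite:
  assumes I: "std_interval I" and P: "\<rho> \<in> class_P"
    and E: "solid_space I E" and F: "solid_space I F"
    and x: "x \<in> elems (Calderon_Lozanovskii I \<rho> (symmetrization I E) (symmetrization I F))"
    and z: "qnorm (Calderon_Lozanovskii I \<rho> (symmetrization I E) (symmetrization I F)) x = 0"
  shows "AE t in lebesgue_on I. x t = 0"
proof -
  let ?B = "CL_bounds I \<rho> (symmetrization I E) (symmetrization I F) x"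
  have xL: "x \<in> L0 I" and ne: "?B \<noteq> {}" and inf: "Inf ?B = 0" using x z by (auto simp: elems_CL qnorm_CL)
  have "rearr I x t = 0" if t: "t \<in> I" for t
  proof -
    have t2: "t / 2 \<in> I" and t0: "0 < t" using std_interval_half[OF I t] std_interval_pos[OF I t] .
    obtain a where a: "0 \<le> a"
      "\<And>x. x \<in> elems (symmetrization I E) \<Longrightarrow> qnorm (symmetrization I E) x \<le> 1 \<Longrightarrow> rearr I x (t / 2) \<le> ennreal a"
      using rearr_bounded_on_unit_ball[OF I E t2] by metis
    obtain b where b: "0 \<le> b"
      "\<And>x. x \<in> elems (symmetrization I F) \<Longrightarrow> qnorm (symmetrization I F) x \<le> 1 \<Longrightarrow> rearr I x (t / 2) \<le> ennreal b"
      using rearr_bounded_on_unit_ball[OF I F t2] by metis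
    \<comment> \<open>Adding 1 makes V a legitimate divisor even when a or b is 0.\<close>
    define V where "V = two_var \<rho> a b + 1"
    have V: "0 < V" "two_var \<rho> a b \<le> V" using two_var_nonneg[OF P b(1), of a] by (auto simp: V_def)
    define r where "r = enn2real (rearr I x t)"
    have le: "rearr I x t \<le> ennreal (c * V)" if c: "c \<in> ?B" for c
    proof -
      obtain x0 x1 where c0: "0 < c" and x0: "x0 \<in> elems (symmetrization I E)" "qnorm (symmetrization I E) x0 \<le> 1"
        and x1: "x1 \<in> elems (symmetrization I F)" "qnorm (symmetrization I F) x1 \<le> 1"
        and ae: "AE t in lebesgue_on I. \<bar>x t\<bar> \<le> c * two_var \<rho> \<bar>x0 t\<bar> \<bar>x1 t\<bar>"
        using c by (auto simp: CL_bounds_def)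
      have "rearr I x t \<le> ennreal (c * two_var \<rho> a b)"
        by (rule rearr_CL_le[OF I P xL c0 x0(1) x1(1) ae t0 a(1) a(2)[OF x0] b(1) b(2)[OF x1]])
      also have "\<dots> \<le> ennreal (c * V)" using V c0 by (intro ennreal_leI mult_left_mono) auto
      finally show ?thesis .
    qed
    have "r / V \<le> Inf ?B"
    proof (rule cInf_greatest[OF ne])
      fix c assume c: "c \<in> ?B"
      have "r \<le> enn2real (ennreal (c * V))"
        unfolding r_def by (rule enn2real_mono[OF le[OF c]]) simp
      then show "r / V \<le> c" using V CL_bounds_nonneg[OF c] by (simp add: pos_divide_le_eq)
    qed
    then have "r \<le> 0" using V inf by (simp add: pos_divide_le_eq)
    moreover have "0 \<le> r" by (simp add: r_def)
    ultimately have "r = 0" by simp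
    moreover obtain c where "c \<in> ?B" using ne by blast
    then have "rearr I x t < \<infinity>" by (rule le_less_trans[OF le]) simp
    ultimately show ?thesis by (auto simp: r_def enn2real_eq_0_iff)
  qed
  then show ?thesis by (intro rearr_zero_imp[OF I xL] AE_I2) auto
qed

lemma CL_symmetrization_quasi_normed:
  assumes I: "std_interval I" and P: "\<rho> \<in> class_P"
    and E: "solid_space I E" "dilation_bounded I E" and F: "solid_space I F" "dilation_bounded I F"
  shows "quasi_normed_space I (Calderon_Lozanovskii I \<rho> (symmetrization I E) (symmetrization I F))"
proof -
  let ?R = "Calderon_Lozanovskii I \<rho> (symmetrization I E) (symmetrization I F)"
  note SE = symmetrization_solid[OF I E] and SF = symmetrization_solid[OF I F]
  obtain K where K: "1 \<le> K" "\<And>x y. x \<in> elems ?R \<Longrightarrow> y \<in> elems ?R \<Longrightarrow>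
      (\<lambda>t. x t + y t) \<in> elems ?R \<and> qnorm ?R (\<lambda>t. x t + y t) \<le> K * (qnorm ?R x + qnorm ?R y)"
    using CL_quasi_triangle[OF P SE SF] by metis
  have "quasi_norm I (elems ?R) (qnorm ?R)"
    unfolding quasi_norm_def
  proof (intro conjI ballI allI impI)
    show "qnorm ?R x = 0 \<longleftrightarrow> (AE t in lebesgue_on I. x t = 0)" if "x \<in> elems ?R" for x
      using CL_symmetrization_definite[OF I P E(1) F(1) that] qnorm_CL_zero[OF P SE SF] by blast
    show "\<exists>K\<ge>1. \<forall>x\<in>elems ?R. \<forall>y\<in>elems ?R. qnorm ?R (\<lambda>t. x t + y t) \<le> K * (qnorm ?R x + qnorm ?R y)"
      using K by blast
    show "qnorm ?R x = qnorm ?R y" if "AE t in lebesgue_on I. x t = y t" for x y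
      using CL_bounds_cong[OF that] by (simp add: qnorm_CL)
  qed (use qnorm_CL_nonneg CL_cmult(2)[OF P SE SF] in blast)+
  then show ?thesis
    using CL_linear_subspace[OF P SE SF] by (simp add: quasi_normed_space_def)
qed

text \<open>A nonzero y has y*(a) > 0 at some a in I, and the indicator of (0,a] is then dominated
  by y*/y*(a). This indicator also dominates its own rearrangement, so membership in E passes to the
  symmetrization.\<close>

lemma symmetrization_indicator:
  assumes I: "std_interval I" and E: "solid_space I E" and d: "dilation_bounded I E"
    and ne: "elems (symmetrization I E) \<noteq> null_class I"
  obtains a where "a \<in> I" "indicator {0<..a} \<in> elems (symmetrization I E)"
proof -
  note SE = symmetrization_solid[OF I E d]
  have "null_class I \<subseteq> elems (symmetrization I E)"
    using solid_cong(1)[OF SE solid_zero[OF SE]] by (auto simp: null_class_def elim: eventually_mono)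
  then obtain y where y: "y \<in> elems (symmetrization I E)" "y \<notin> null_class I" using ne by blast
  then have yL: "y \<in> L0 I" and mem: "ext_mem I (rearr I y) E"
    and mem': "(\<lambda>t. enn2real (rearr I y t)) \<in> elems E"
    by (auto simp: elems_symmetrization ext_mem_def)
  obtain a where a: "a \<in> I" "rearr I y a \<noteq> 0"
    using rearr_zero_imp[OF I yL] y(2) yL by (force simp: null_class_def)
  have a0: "0 < a" using std_interval_pos[OF I a(1)] .
  define ind where "ind = (indicator {0<..a} :: real \<Rightarrow> real)"
  have indL: "ind \<in> L0 I" unfolding ind_def by (rule borel_in_L0) simp
  define k where "k = enn2real (rearr I y a)"
  have "k \<noteq> 0"
    using ennreal_enn2real_rearr[OF I mem a0] a(2) by (auto simp: k_def)
  have "AE s in lebesgue_on I. \<bar>k * ind s\<bar> \<le> \<bar>enn2real (rearr I y s)\<bar>"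
    unfolding k_def ind_def using rearr_ge_indicator[OF I mem a0] by (intro AE_I2)
  from solid_ideal(1)[OF E mem' L0_cmult[OF indL] this]
  have "(\<lambda>s. (1 / k) * (k * ind s)) \<in> elems E" by (rule solid_cmult[OF E])
  then have indE: "ind \<in> elems E" using \<open>k \<noteq> 0\<close> by simp
  have "rearr I ind s \<le> ennreal (ind s)" if s: "s \<in> I" for s
  proof (subst rearr_le_iff[OF indL])
    have "emeasure (lebesgue_on I) {v \<in> I. \<bar>ind v\<bar> > ind s} \<le> emeasure (lebesgue_on I) (if s \<in> {0<..a} then {} else {0<..a})"
      using std_interval_Ioc[OF I a(1)] std_interval_sets[OF I]
      by (intro emeasure_mono) (auto simp: ind_def indicator_def sets_restrict_space_iff split: if_splits)
    also have "\<dots> \<le> ennreal s"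
      using std_interval_Ioc[OF I a(1)] std_interval_pos[OF I s] a0
      by (auto simp: emeasure_std_interval[OF I] intro: ennreal_leI)
    finally show "emeasure (lebesgue_on I) {v \<in> I. \<bar>ind v\<bar> > ind s} \<le> ennreal s" .
  qed (simp add: ind_def)
  then have "AE s in lebesgue_on I. rearr I ind s \<le> ennreal (ind s)" by (intro AE_I2) simp
  from ext_mem_ideal(1)[OF E indE rearr_antimono this]
  show ?thesis using that[OF a(1)] indL by (simp add: elems_symmetrization ind_def)
qed

text \<open>The shorter of two initial intervals has its indicator in both symmetrizations, and
  \<open>two_var\<close> of this indicator with itself is \<open>two_var \<rho> 1 1\<close> times
  the indicator.\<close>

lemma CL_symmetrization_nontrivial:
  assumes I: "std_interval I" and P: "\<rho> \<in> class_P"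
    and E: "solid_space I E" "dilation_bounded I E" "elems (symmetrization I E) \<noteq> null_class I"
    and F: "solid_space I F" "dilation_bounded I F" "elems (symmetrization I F) \<noteq> null_class I"
  shows "elems (Calderon_Lozanovskii I \<rho> (symmetrization I E) (symmetrization I F)) \<noteq> null_class I"
proof -
  let ?E = "symmetrization I E" and ?F = "symmetrization I F"
  note SE = symmetrization_solid[OF I E(1,2)] and SF = symmetrization_solid[OF I F(1,2)]
  obtain a where a: "a \<in> I" "indicator {0<..a} \<in> elems ?E"
    using symmetrization_indicator[OF I E] by metis
  obtain b where b: "b \<in> I" "indicator {0<..b} \<in> elems ?F"
    using symmetrization_indicator[OF I F] by metis
  define d where "d = min a b"
  have d: "d \<in> I" "d \<le> a" "d \<le> b" using a b by (auto simp: d_def min_def)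
  define ind where "ind = (indicator {0<..d} :: real \<Rightarrow> real)"
  have indL: "ind \<in> L0 I" unfolding ind_def by (rule borel_in_L0) simp
  have ind: "ind \<in> elems ?E" "ind \<in> elems ?F"
    by (rule solid_ideal(1)[OF SE a(2) indL] solid_ideal(1)[OF SF b(2) indL];
        intro AE_I2; use d in \<open>auto simp: ind_def indicator_def\<close>)+
  define N where "N = 1 + max (qnorm ?E ind) (qnorm ?F ind)"
  have N: "0 < N" "qnorm ?E ind \<le> N" "qnorm ?F ind \<le> N"
    using solid_norm_nonneg[OF SE ind(1)] by (auto simp: N_def)
  have p: "0 < two_var \<rho> 1 1" by (rule two_var_pos[OF P]) auto
  have "AE t in lebesgue_on I. \<bar>ind t\<bar> \<le> (1 / two_var \<rho> 1 1) * two_var \<rho> \<bar>ind t\<bar> \<bar>ind t\<bar>"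
    using p by (intro AE_I2) (auto simp: ind_def indicator_def two_var_zero[OF P])
  then have "(1 / two_var \<rho> 1 1) * N \<in> CL_bounds I \<rho> ?E ?F ind"
    using p by (intro CL_boundsI[OF P SE SF _ N(1) ind(1) N(2) ind(2) N(3)]) auto
  then have "ind \<in> elems (Calderon_Lozanovskii I \<rho> ?E ?F)"
    using indL by (auto simp: elems_CL)
  moreover have "ind \<notin> null_class I"
  proof
    assume "ind \<in> null_class I"
    then have "AE s in lebesgue_on I. ind s = 0" by (simp add: null_class_def)
    then obtain s where "0 < s" "s < d" "ind s = 0"
      by (rule AE_lebesgue_on_ex[OF I])
        (use std_interval_pos[OF I d(1)] std_interval_Ioc[OF I d(1)] in auto)
    then show False by (simp add: ind_def)
  qed
  ultimately show ?thesis by blast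
qed

subsection \<open>The Hardy operator\<close>

lemma ennreal_powr_mono: "z \<le> w \<Longrightarrow> 0 \<le> p \<Longrightarrow> ennreal_powr z p \<le> ennreal_powr w p"
  by (auto simp: ennreal_powr_def top_unique less_top intro!: ennreal_leI powr_mono2 enn2real_mono)

lemma ennreal_powr_eq:
  assumes "0 < r" "0 \<le> a" "ennreal_powr z (1 / r) = ennreal a"
  shows "z = ennreal (a powr r)"
proof (cases z)
  case (real w)
  then have "w powr (1 / r) = a" using assms by (simp add: ennreal_powr_def)
  then have "a powr r = w" using assms real by (auto simp: powr_powr)
  then show ?thesis using real by simp
qed (use assms in \<open>simp add: ennreal_powr_def\<close>)

lemma Hstar_antimono:
  assumes "0 < r"
  shows "antimono (Hstar I r x)"
proof (rule antimonoI)
  fix s t :: real assume "s \<le> t"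
  then show "Hstar I r x t \<le> Hstar I r x s"
    unfolding Hstar_def using assms
    by (intro ennreal_powr_mono nn_integral_mono) (auto simp: indicator_def)
qed

text \<open>On (D/2,D) one has 1 \<le> D/s, so the weight 1/s can be inserted at the price of D. As
  the interval has length D/2, the mean of |x|^r is at most 2 a^r.\<close>

lemma Hstar_average:
  assumes I: "std_interval I" and x: "x \<in> L0 I" and r: "0 < r" and D: "0 < D" "{D / 2<..<D} \<subseteq> I"
    and a: "0 \<le> a" "Hstar I r x (D / 2) = ennreal a"
  shows "(\<integral>\<^sup>+s. ennreal (\<bar>x s\<bar> powr r) * indicator {D / 2<..<D} s \<partial>lebesgue_on I) \<le> ennreal (D * a powr r)"
proof -
  have [measurable]: "x \<in> borel_measurable (lebesgue_on I)" using x by (simp add: L0_def)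
  have [measurable]: "(\<lambda>s::real. s) \<in> borel_measurable (lebesgue_on I)"
    using borel_in_L0[of "\<lambda>s::real. s" I] by (simp add: L0_def)
  have S: "{s \<in> I. D / 2 < s} \<in> sets (lebesgue_on I)"
  proof -
    have "{s \<in> space (lebesgue_on I). D / 2 < s} \<in> sets (lebesgue_on I)" by measurable
    then show ?thesis by simp
  qed
  have "(\<integral>\<^sup>+s. ennreal (\<bar>x s\<bar> powr r) * indicator {D / 2<..<D} s \<partial>lebesgue_on I)
      \<le> (\<integral>\<^sup>+s. ennreal D * (ennreal (\<bar>x s\<bar> powr r / s) * indicator {s \<in> I. D / 2 < s} s) \<partial>lebesgue_on I)"
  proof (rule nn_integral_mono)
    fix s
    show "ennreal (\<bar>x s\<bar> powr r) * indicator {D / 2<..<D} s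
        \<le> ennreal D * (ennreal (\<bar>x s\<bar> powr r / s) * indicator {s \<in> I. D / 2 < s} s)"
    proof (cases "s \<in> {D / 2<..<D}")
      case True
      then have s: "0 < s" "s < D" "s \<in> I" using D by auto
      have "s * \<bar>x s\<bar> powr r \<le> D * \<bar>x s\<bar> powr r"
        using s by (intro mult_right_mono) auto
      then have "\<bar>x s\<bar> powr r \<le> D * (\<bar>x s\<bar> powr r / s)"
        using s by (simp add: pos_le_divide_eq mult.commute)
      then show ?thesis using True s D by (simp add: ennreal_mult'[symmetric] ennreal_leI)
    qed simp
  qed
  also have "\<dots> = ennreal D * (\<integral>\<^sup>+s. ennreal (\<bar>x s\<bar> powr r / s) * indicator {s \<in> I. D / 2 < s} s \<partial>lebesgue_on I)"
    by (intro nn_integral_cmult borel_measurable_times_ennreal borel_measurable_indicator S) measurable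
  also have "\<dots> = ennreal D * ennreal (a powr r)"
    using ennreal_powr_eq[OF r a(1)] a(2) by (simp add: Hstar_def)
  also have "\<dots> = ennreal (D * a powr r)"
    using D by (simp add: ennreal_mult')
  finally show ?thesis .
qed

text \<open>Settles the degenerate case of the Jensen estimate, whose tangent requires both values
  of the Hardy operator to be positive.\<close>

lemma Hstar_zero:
  assumes I: "std_interval I" and x: "x \<in> L0 I" and r: "0 < r" and D: "0 < D" "{D / 2<..<D} \<subseteq> I"
    and a: "Hstar I r x (D / 2) = 0"
  shows "AE s in lebesgue_on I. s \<in> {D / 2<..<D} \<longrightarrow> x s = 0"
proof -
  have [measurable]: "x \<in> borel_measurable (lebesgue_on I)" using x by (simp add: L0_def)
  have [measurable]: "{D / 2<..<D} \<in> sets (lebesgue_on I)"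
    using D std_interval_sets[OF I] by (simp add: sets_restrict_space_iff)
  have "(\<integral>\<^sup>+s. ennreal (\<bar>x s\<bar> powr r) * indicator {D / 2<..<D} s \<partial>lebesgue_on I) = 0"
    using Hstar_average[OF I x r D, of 0] a r by simp
  then have "AE s in lebesgue_on I. ennreal (\<bar>x s\<bar> powr r) * indicator {D / 2<..<D} s = 0"
    by (subst (asm) nn_integral_0_iff_AE) measurable
  then show ?thesis
    by eventually_elim (auto simp: indicator_def split: if_splits)
qed

text \<open>Jensen's inequality on \<open>(D/2, D)\<close>: \<open>\<rho>\<close> is replaced by its tangent at the point formed by the
  two \<open>r\<close>-th power means, and the constant \<open>max 1 (2 powr (1 / r - 1))\<close> is the one of the
  quasi-triangle inequality in \<open>L\<^sup>r\<close>.\<close>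

lemma two_var_Hstar_estimate:
  assumes I: "std_interval I" and P: "\<rho> \<in> class_P" and r: "0 < r"
    and x0: "x0 \<in> L0 I" and x1: "x1 \<in> L0 I" and D: "0 < D" "{D / 2<..<D} \<subseteq> I"
    and v: "0 < v" and c: "0 < c"
    and ae: "AE s in lebesgue_on I. s \<in> {D / 2<..<D} \<longrightarrow> v \<le> c * two_var \<rho> \<bar>x0 s\<bar> \<bar>x1 s\<bar>"
    and a: "0 \<le> a" "Hstar I r x0 (D / 2) = ennreal a"
    and b: "0 \<le> b" "Hstar I r x1 (D / 2) = ennreal b"
  shows "v \<le> c * (2 powr (1 / r) * max 1 (2 powr (1 / r - 1))) * two_var \<rho> a b"
proof -
  let ?M = "lebesgue_on I" and ?J = "{D / 2<..<D}"
  have [measurable]: "x0 \<in> borel_measurable ?M" "x1 \<in> borel_measurable ?M"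
    using x0 x1 by (simp_all add: L0_def)
  have J[measurable]: "?J \<in> sets ?M"
    using D std_interval_sets[OF I] by (simp add: sets_restrict_space_iff)
  have DJ: "D / 2 < D" using D by simp
  \<comment> \<open>If a = 0, then x0 vanishes a.e. on the interval and the hypothesis would give v
    \<le> 0 there.\<close>
  have "a \<noteq> 0"
  proof
    assume "a = 0"
    then have "AE s in ?M. s \<in> ?J \<longrightarrow> x0 s = 0" using Hstar_zero[OF I x0 r D] a by simp
    then have "AE s in ?M. s \<notin> ?J"
      using ae by eventually_elim (use v c in \<open>auto simp: two_var_zero[OF P]\<close>)
    then obtain s where "D / 2 < s" "s < D" "s \<notin> ?J"
      by (rule AE_lebesgue_on_ex[OF I _ DJ D(2)])
    then show False by simp
  qed
  moreover have "b \<noteq> 0"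
  proof
    assume "b = 0"
    then have "AE s in ?M. s \<in> ?J \<longrightarrow> x1 s = 0" using Hstar_zero[OF I x1 r D] b by simp
    then have "AE s in ?M. s \<notin> ?J"
      using ae by eventually_elim (use v c in \<open>auto simp: two_var_zero[OF P]\<close>)
    then obtain s where "D / 2 < s" "s < D" "s \<notin> ?J"
      by (rule AE_lebesgue_on_ex[OF I _ DJ D(2)])
    then show False by simp
  qed
  ultimately have ab: "0 < a" "0 < b" using a b by auto
  \<comment> \<open>k a bounds the r-th power mean of x0 over the interval, because k^r = 2 matches
    the factor from \<open>Hstar_average\<close>; likewise k b for x1.\<close>
  define k :: real where "k = 2 powr (1 / r)"
  have k: "0 < k" "k powr r = 2" using r by (simp_all add: k_def powr_powr)
  have kab: "0 < k * a" "0 < k * b" using k ab by auto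
  obtain \<alpha> \<beta> where tang: "0 \<le> \<alpha>" "0 \<le> \<beta>" "two_var \<rho> (k * a) (k * b) = \<alpha> * (k * a) + \<beta> * (k * b)"
    "\<And>s t. 0 \<le> s \<Longrightarrow> 0 \<le> t \<Longrightarrow> two_var \<rho> s t \<le> \<alpha> * s + \<beta> * t"
    using two_var_tangent[OF P kab] by metis
  define T where "T = two_var \<rho> (k * a) (k * b)"
  have T: "0 < T" unfolding T_def by (rule two_var_pos[OF P kab])
  \<comment> \<open>The shares of the two tangent terms in T. Dividing the tangent inequality by T
    bounds \<rho>(|x0|,|x1|)/T by p \<xi> + q \<eta> with \<xi> = |x0|/(k a) and \<eta> = |x1|/(k
    b).\<close>
  define p where "p = \<alpha> * (k * a) / T"
  define q where "q = \<beta> * (k * b) / T"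
  have pq: "0 \<le> p" "0 \<le> q" "p + q = 1"
    using tang kab T by (auto simp: p_def q_def T_def[symmetric] add_divide_distrib[symmetric])
  define m :: real where "m = max 1 (2 powr (1 / r - 1))"
  have m: "1 \<le> m" by (simp add: m_def)
  obtain w1 w2 where w: "0 \<le> w1" "0 \<le> w2" "w1 + w2 \<le> m powr r"
    "\<And>\<xi> \<eta>. 0 \<le> \<xi> \<Longrightarrow> 0 \<le> \<eta> \<Longrightarrow> (p * \<xi> + q * \<eta>) powr r \<le> w1 * \<xi> powr r + w2 * \<eta> powr r"
    using powr_convex_combination_bound[OF r pq] unfolding m_def by metis
  \<comment> \<open>The weights w1 and w2 after extracting |x0|^r and |x1|^r from the normalised
    powers, using k^r = 2.\<close>
  define k1 where "k1 = w1 / (2 * a powr r)"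
  define k2 where "k2 = w2 / (2 * b powr r)"
  have k12: "0 \<le> k1" "0 \<le> k2" using w by (auto simp: k1_def k2_def)
  define V where "V = (v / (c * T)) powr r"
  have point: "AE s in ?M. s \<in> ?J \<longrightarrow> V \<le> k1 * \<bar>x0 s\<bar> powr r + k2 * \<bar>x1 s\<bar> powr r"
    using ae
  proof (eventually_elim, intro impI)
    fix s
    define X where "X = p * (\<bar>x0 s\<bar> / (k * a))"
    define Y where "Y = q * (\<bar>x1 s\<bar> / (k * b))"
    assume "s \<in> ?J \<longrightarrow> v \<le> c * two_var \<rho> \<bar>x0 s\<bar> \<bar>x1 s\<bar>" "s \<in> ?J"
    then have "v \<le> c * two_var \<rho> \<bar>x0 s\<bar> \<bar>x1 s\<bar>" by simp
    also have "\<dots> \<le> c * (\<alpha> * \<bar>x0 s\<bar> + \<beta> * \<bar>x1 s\<bar>)"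
      using c tang(4) by (intro mult_left_mono) auto
    also have "\<alpha> * \<bar>x0 s\<bar> = T * X"
      using T k ab by (simp add: X_def p_def)
    also have "\<beta> * \<bar>x1 s\<bar> = T * Y"
      using T k ab by (simp add: Y_def q_def)
    finally have "v \<le> (X + Y) * (c * T)"
      by (simp add: algebra_simps)
    then have "v / (c * T) \<le> X + Y"
      using c T by (simp add: pos_divide_le_eq)
    then have "V \<le> (X + Y) powr r"
      unfolding V_def using v c T r by (intro powr_mono2) auto
    also have "\<dots> \<le> w1 * (\<bar>x0 s\<bar> / (k * a)) powr r + w2 * (\<bar>x1 s\<bar> / (k * b)) powr r"
      unfolding X_def Y_def using kab by (intro w(4)) auto
    also have "\<dots> = k1 * \<bar>x0 s\<bar> powr r + k2 * \<bar>x1 s\<bar> powr r"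
      using kab k ab by (simp add: powr_divide powr_mult k1_def k2_def)
    finally show "V \<le> k1 * \<bar>x0 s\<bar> powr r + k2 * \<bar>x1 s\<bar> powr r" .
  qed
  have "emeasure ?M ?J = ennreal (D / 2)"
    using D by (simp add: emeasure_std_interval[OF I D(2)])
  then have "ennreal (V * (D / 2)) = ennreal V * emeasure ?M ?J"
    using D V_def by (simp only: ennreal_mult' powr_ge_zero)
  also have "\<dots> = (\<integral>\<^sup>+s. ennreal V * indicator ?J s \<partial>?M)"
    by (simp add: nn_integral_cmult_indicator[OF J])
  also have "\<dots> \<le> (\<integral>\<^sup>+s. ennreal k1 * (ennreal (\<bar>x0 s\<bar> powr r) * indicator ?J s)
      + ennreal k2 * (ennreal (\<bar>x1 s\<bar> powr r) * indicator ?J s) \<partial>?M)"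
  proof (rule nn_integral_mono_AE)
    show "AE s in ?M. ennreal V * indicator ?J s \<le> ennreal k1 * (ennreal (\<bar>x0 s\<bar> powr r) * indicator ?J s)
      + ennreal k2 * (ennreal (\<bar>x1 s\<bar> powr r) * indicator ?J s)"
      using point
    proof eventually_elim
      case (elim s)
      show ?case
      proof (cases "s \<in> ?J")
        case True
        then have "ennreal V \<le> ennreal (k1 * \<bar>x0 s\<bar> powr r + k2 * \<bar>x1 s\<bar> powr r)"
          using elim by (intro ennreal_leI) simp
        also have "\<dots> = ennreal k1 * ennreal (\<bar>x0 s\<bar> powr r) + ennreal k2 * ennreal (\<bar>x1 s\<bar> powr r)"
          using k12 by (simp add: ennreal_plus ennreal_mult')
        finally show ?thesis using True by simp
      qed simp
    qed
  qed
  also have "\<dots> = ennreal k1 * (\<integral>\<^sup>+s. ennreal (\<bar>x0 s\<bar> powr r) * indicator ?J s \<partial>?M)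
      + ennreal k2 * (\<integral>\<^sup>+s. ennreal (\<bar>x1 s\<bar> powr r) * indicator ?J s \<partial>?M)"
    by (subst nn_integral_add) (measurable, simp add: nn_integral_cmult)
  also have "\<dots> \<le> ennreal k1 * ennreal (D * a powr r) + ennreal k2 * ennreal (D * b powr r)"
    by (intro add_mono mult_left_mono Hstar_average[OF I x0 r D a] Hstar_average[OF I x1 r D b]) auto
  also have "\<dots> = ennreal (k1 * (D * a powr r) + k2 * (D * b powr r))"
    using k12 D by (simp add: ennreal_plus ennreal_mult')
  finally have "V * (D / 2) \<le> k1 * (D * a powr r) + k2 * (D * b powr r)"
    using k12 D by (subst (asm) ennreal_le_iff) auto
  \<comment> \<open>The normalisation by 2 a^r and 2 b^r cancels exactly the bounds of the two
    integrals, so only the sum of the weights remains.\<close>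
  also have "\<dots> = (w1 + w2) * (D / 2)"
    using ab by (simp add: k1_def k2_def field_simps)
  also have "\<dots> \<le> m powr r * (D / 2)"
    using w D by (intro mult_right_mono) auto
  finally have "V \<le> m powr r" using D by simp
  then have "V powr (1 / r) \<le> (m powr r) powr (1 / r)"
    using r by (intro powr_mono2) (auto simp: V_def)
  then have "v / (c * T) \<le> m"
    using r v c T m by (simp add: V_def powr_powr)
  then have "v \<le> m * (c * T)" using c T by (simp add: pos_divide_le_eq)
  also have "T = k * two_var \<rho> a b"
    unfolding T_def by (rule two_var_homogeneous[OF k(1)])
  finally show ?thesis by (simp add: m_def k_def mult_ac)
qed

section \<open>Level sets of x and transport along them\<close>

lemma rearr_ge:
  assumes x: "x \<in> L0 I" and v: "0 < v" and t: "ennreal t < emeasure (lebesgue_on I) {s \<in> I. \<bar>x s\<bar> \<ge> v}"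
  shows "ennreal v \<le> rearr I x t"
proof (rule ccontr)
  assume "\<not> ennreal v \<le> rearr I x t"
  then have lt: "rearr I x t < ennreal v" by simp
  then obtain c where c: "0 \<le> c" "rearr I x t = ennreal c"
    by (cases "rearr I x t") auto
  then have "c < v" using lt by (simp add: ennreal_less_iff)
  then have "emeasure (lebesgue_on I) {s \<in> I. \<bar>x s\<bar> \<ge> v} \<le> emeasure (lebesgue_on I) {s \<in> I. \<bar>x s\<bar> > c}"
    by (intro emeasure_mono level_set_sets x) auto
  also have "\<dots> \<le> ennreal t" using rearr_le_iff[OF x c(1)] c(2) by (metis order_refl)
  finally show False using t by simp
qed

text \<open>Put c = x*(t). Every s in A satisfies |x s| \<ge> c. If c is attained on A, then A lies
  in {|x| \<ge> c}, which is one of the sets of measure below t; otherwise A lies in {|x| > c}, of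
  measure at most t by the definition of c. The distinction is what handles jumps of the
  distribution function.\<close>

lemma emeasure_small_levels:
  assumes x: "x \<in> L0 I"
    and A: "\<And>s. s \<in> A \<Longrightarrow> s \<in> I"
      "\<And>s. s \<in> A \<Longrightarrow> emeasure (lebesgue_on I) {u \<in> I. \<bar>x u\<bar> \<ge> \<bar>x s\<bar>} < ennreal t"
  shows "emeasure (lebesgue_on I) A \<le> ennreal t"
proof (cases "A = {}")
  case False
  let ?M = "lebesgue_on I"
  have below: "rearr I x t \<le> ennreal \<bar>x s\<bar>" if "s \<in> A" for s
  proof (subst rearr_le_iff[OF x])
    have "emeasure ?M {u \<in> I. \<bar>x u\<bar> > \<bar>x s\<bar>} \<le> emeasure ?M {u \<in> I. \<bar>x u\<bar> \<ge> \<bar>x s\<bar>}"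
      by (intro emeasure_mono level_set_sets x) auto
    then show "emeasure ?M {u \<in> I. \<bar>x u\<bar> > \<bar>x s\<bar>} \<le> ennreal t"
      using A(2)[OF that] by simp
  qed simp
  obtain s where "s \<in> A" using False by blast
  from below[OF this] have "rearr I x t \<noteq> top" by (auto simp: top_unique)
  then obtain c where c: "0 \<le> c" "rearr I x t = ennreal c" by (cases "rearr I x t") auto
  have ge: "c \<le> \<bar>x s\<bar>" if "s \<in> A" for s using below[OF that] c by simp
  show ?thesis
  proof (cases "\<exists>s\<in>A. \<bar>x s\<bar> = c")
    case True
    then have "emeasure ?M {u \<in> I. \<bar>x u\<bar> \<ge> c} < ennreal t" using A(2) by auto
    moreover have "emeasure ?M A \<le> emeasure ?M {u \<in> I. \<bar>x u\<bar> \<ge> c}"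
      using ge A(1) by (intro emeasure_mono level_set_sets x) auto
    ultimately show ?thesis by simp
  next
    case False
    have "emeasure ?M A \<le> emeasure ?M {u \<in> I. \<bar>x u\<bar> > c}"
      using ge A(1) False by (intro emeasure_mono level_set_sets x) (force simp: less_le)
    also have "\<dots> \<le> ennreal t" using rearr_le_iff[OF x c(1)] c(2) by (metis order_refl)
    finally show ?thesis .
  qed
qed simp


text \<open>Only the half line needs an argument. There an infinite level set forces x* \<ge> v
  everywhere, hence a positive lower bound \<delta> for |x0|^r + |x1|^r. The integral of \<delta>/s
  over [1,n] grows without bound, while the Hardy integrals over (1/2,\<infinity>) are finite.
  Finiteness is what makes \<open>level_pullback\<close> meaningful, since \<open>enn2real\<close>
  sends infinite measure to 0.\<close>

lemma emeasure_level_finite: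
  assumes I: "std_interval I" and P: "\<rho> \<in> class_P" and r: "0 < r"
    and x: "x \<in> L0 I" and c: "0 < c" and v: "0 < v"
    and ae: "AE t in lebesgue_on I. rearr I x t \<le> ennreal (c * two_var \<rho> \<bar>x0 t\<bar> \<bar>x1 t\<bar>)"
    and x0: "x0 \<in> L0 I" "Hstar I r x0 (1 / 2) < \<infinity>" and x1: "x1 \<in> L0 I" "Hstar I r x1 (1 / 2) < \<infinity>"
  shows "emeasure (lebesgue_on I) {s \<in> I. \<bar>x s\<bar> \<ge> v} < \<infinity>"
proof (rule ccontr)
  let ?M = "lebesgue_on I" and ?S = "{s \<in> I. 1 / 2 < s}"
  assume "\<not> emeasure ?M {s \<in> I. \<bar>x s\<bar> \<ge> v} < \<infinity>"
  then have inf: "emeasure ?M {s \<in> I. \<bar>x s\<bar> \<ge> v} = \<infinity>" by (simp add: less_top[symmetric])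
  have I_eq: "I = {0<..}"
  proof (rule ccontr)
    assume "I \<noteq> {0<..}"
    then have "I = {0<..<1}" using I by (auto simp: std_interval_def)
    then have "emeasure ?M I = 1" using emeasure_std_interval[OF I order_refl] by simp
    moreover have "emeasure ?M {s \<in> I. \<bar>x s\<bar> \<ge> v} \<le> emeasure ?M I"
      by (intro emeasure_mono) (auto simp: sets_restrict_space_iff std_interval_sets[OF I])
    ultimately show False using inf by (simp add: top_unique)
  qed
  have [measurable]: "x0 \<in> borel_measurable ?M" "x1 \<in> borel_measurable ?M"
    "(\<lambda>s::real. s) \<in> borel_measurable ?M"
    using x0 x1 borel_in_L0[of "\<lambda>s::real. s" I] by (simp_all add: L0_def)
  have S: "?S \<in> sets ?M"
    using I_eq by (auto simp: sets_restrict_space_iff)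
  define R1 where "R1 = two_var \<rho> 1 1"
  have R1: "0 < R1" unfolding R1_def by (rule two_var_pos[OF P]) auto
  \<comment> \<open>With m the larger of |x0 t| and |x1 t|, monotonicity and homogeneity give v
    \<le> c m R1, and so \<delta> \<le> m^r.\<close>
  define \<delta> where "\<delta> = (v / (c * R1)) powr r"
  have \<delta>: "0 < \<delta>" using v c R1 by (simp add: \<delta>_def)
  have low: "AE t in ?M. \<delta> \<le> \<bar>x0 t\<bar> powr r + \<bar>x1 t\<bar> powr r"
    using ae
  proof eventually_elim
    case (elim t)
    define m where "m = max \<bar>x0 t\<bar> \<bar>x1 t\<bar>"
    have "ennreal v \<le> rearr I x t"
      using inf by (intro rearr_ge[OF x v]) simp
    then have "ennreal v \<le> ennreal (c * two_var \<rho> \<bar>x0 t\<bar> \<bar>x1 t\<bar>)" using elim by (rule order_trans)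
    then have "v \<le> c * two_var \<rho> \<bar>x0 t\<bar> \<bar>x1 t\<bar>"
      using c two_var_nonneg[OF P, of "\<bar>x1 t\<bar>"] by (subst (asm) ennreal_le_iff) auto
    also have "\<dots> \<le> c * two_var \<rho> m m"
      using c by (intro mult_left_mono two_var_mono[OF P]) (auto simp: m_def)
    finally have le: "v \<le> c * two_var \<rho> m m" .
    have "m \<noteq> 0" using le v two_var_zero[OF P, of 0 0] by auto
    then have m: "0 < m" by (auto simp: m_def max_def)
    have "v \<le> m * (c * R1)"
      using le two_var_homogeneous[OF m, of \<rho> 1 1] by (simp add: R1_def mult_ac)
    then have "v / (c * R1) \<le> m" using c R1 by (simp add: pos_divide_le_eq)
    then have "\<delta> \<le> m powr r" unfolding \<delta>_def using v c R1 r by (intro powr_mono2) auto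
    also have "\<dots> \<le> \<bar>x0 t\<bar> powr r + \<bar>x1 t\<bar> powr r" by (auto simp: m_def max_def)
    finally show ?case .
  qed
  obtain a where a: "0 \<le> a" "Hstar I r x0 (1 / 2) = ennreal a"
    using x0(2) by (cases "Hstar I r x0 (1 / 2)") auto
  obtain b where b: "0 \<le> b" "Hstar I r x1 (1 / 2) = ennreal b"
    using x1(2) by (cases "Hstar I r x1 (1 / 2)") auto
  have ints: "(\<integral>\<^sup>+s. ennreal (\<bar>x0 s\<bar> powr r / s) * indicator ?S s \<partial>?M) = ennreal (a powr r)"
    "(\<integral>\<^sup>+s. ennreal (\<bar>x1 s\<bar> powr r / s) * indicator ?S s \<partial>?M) = ennreal (b powr r)"
    using ennreal_powr_eq[OF r a(1)] a(2) ennreal_powr_eq[OF r b(1)] b(2) by (simp_all add: Hstar_def)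
  \<comment> \<open>Chosen so that the integral of \<delta>/s over [1,n] exceeds the sum of the two
    Hardy integrals by exactly 1.\<close>
  define n where "n = exp ((a powr r + b powr r + 1) / \<delta>)"
  have n: "1 \<le> n" using \<delta> by (simp add: n_def add_nonneg_nonneg)
  have "(\<integral>\<^sup>+s. ennreal (\<delta> / s) * indicator {1..n} s \<partial>lborel) = ennreal (\<delta> * ln n - \<delta> * ln 1)"
    using \<delta> n by (intro nn_integral_FTC_Icc) (auto intro!: derivative_eq_intros)
  also have "\<delta> * ln n - \<delta> * ln 1 = a powr r + b powr r + 1"
    using \<delta> by (simp add: n_def)
  finally have "ennreal (a powr r + b powr r + 1) = (\<integral>\<^sup>+s. ennreal (\<delta> / s) * indicator {1..n} s \<partial>lebesgue)"
    by (simp add: nn_integral_completion)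
  also have "\<dots> = (\<integral>\<^sup>+s. ennreal (\<delta> / s) * indicator {1..n} s * indicator I s \<partial>lebesgue)"
    by (intro nn_integral_cong) (auto simp: I_eq indicator_def)
  also have "\<dots> = (\<integral>\<^sup>+s. ennreal (\<delta> / s) * indicator {1..n} s \<partial>?M)"
    using std_interval_sets[OF I] by (simp add: nn_integral_restrict_space)
  also have "\<dots> \<le> (\<integral>\<^sup>+s. ennreal (\<bar>x0 s\<bar> powr r / s) * indicator ?S s
      + ennreal (\<bar>x1 s\<bar> powr r / s) * indicator ?S s \<partial>?M)"
  proof (rule nn_integral_mono_AE)
    show "AE s in ?M. ennreal (\<delta> / s) * indicator {1..n} s
        \<le> ennreal (\<bar>x0 s\<bar> powr r / s) * indicator ?S s + ennreal (\<bar>x1 s\<bar> powr r / s) * indicator ?S s"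
      using low
    proof eventually_elim
      case (elim s)
      show ?case
      proof (cases "s \<in> {1..n}")
        case True
        then have s: "0 < s" "s \<in> ?S" by (auto simp: I_eq)
        have "ennreal (\<delta> / s) \<le> ennreal (\<bar>x0 s\<bar> powr r / s + \<bar>x1 s\<bar> powr r / s)"
          using elim s by (intro ennreal_leI) (simp add: add_divide_distrib[symmetric] divide_right_mono)
        also have "\<dots> = ennreal (\<bar>x0 s\<bar> powr r / s) + ennreal (\<bar>x1 s\<bar> powr r / s)"
          using s by (intro ennreal_plus) auto
        finally show ?thesis using True s by simp
      qed simp
    qed
  qed
  also have "\<dots> = ennreal (a powr r) + ennreal (b powr r)"
    unfolding ints[symmetric]
    by (intro nn_integral_add borel_measurable_times_ennreal borel_measurable_indicator S) measurable
  also have "\<dots> = ennreal (a powr r + b powr r)" by (simp add: ennreal_plus)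
  finally have "a powr r + b powr r + 1 \<le> a powr r + b powr r"
    by (subst (asm) ennreal_le_iff) auto
  then show False by simp
qed

text \<open>Transports a decreasing majorant back along \<open>x\<close>, playing the role of a measure preserving map
  with \<open>|x| = x* \<circ> \<sigma>\<close>: on the level set \<open>{|x| = v}\<close> the majorant is evaluated at half of the
  right end point of the interval on which \<open>x* = v\<close>.\<close>

definition level_pullback :: "real set \<Rightarrow> (real \<Rightarrow> real) \<Rightarrow> (real \<Rightarrow> ennreal) \<Rightarrow> real \<Rightarrow> real" where
  "level_pullback I x h s =
     (let d = enn2real (emeasure (lebesgue_on I) {u \<in> I. \<bar>x u\<bar> \<ge> \<bar>x s\<bar>})
      in if 0 < \<bar>x s\<bar> \<and> 0 < d then enn2real (h (d / 2)) else 0)"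

lemma level_pullback_nonneg: "0 \<le> level_pullback I x h s"
  by (simp add: level_pullback_def Let_def)

text \<open>The function depends on s only through |x s|, by way of two monotone functions: the
  measure of the level set and h.\<close>

lemma level_pullback_L0:
  assumes x: "x \<in> L0 I" and h: "antimono h"
  shows "level_pullback I x h \<in> L0 I"
proof -
  define D where "D v = emeasure (lebesgue_on I) {u \<in> I. \<bar>x u\<bar> \<ge> v}" for v
  have "antimono D"
    unfolding D_def by (intro antimonoI emeasure_mono level_set_sets x) auto
  from antimono_borel_measurable[OF this] have [measurable]: "D \<in> borel_measurable borel" .
  from antimono_borel_measurable[OF h] have [measurable]: "h \<in> borel_measurable borel" .
  have [measurable]: "x \<in> borel_measurable (lebesgue_on I)" using x by (simp add: L0_def)
  have "level_pullback I x h = (\<lambda>s. if 0 < \<bar>x s\<bar> \<and> 0 < enn2real (D \<bar>x s\<bar>)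
      then enn2real (h (enn2real (D \<bar>x s\<bar>) / 2)) else 0)"
    by (simp add: fun_eq_iff level_pullback_def D_def Let_def)
  also have "\<dots> \<in> borel_measurable (lebesgue_on I)" by measurable
  finally show ?thesis by (simp add: L0_def)
qed

text \<open>Where the pullback exceeds h(t/2), the measure d of the level set is below t, since h
  decreases. By \<open>emeasure_small_levels\<close> such points fill a set of measure at most t.
  Evaluation at d/2 is thus what brings the dilation, and with it A_E and A_F, into (ii).\<close>

lemma rearr_level_pullback:
  assumes I: "std_interval I" and x: "x \<in> L0 I" and h: "antimono h" and fin: "\<And>t. 0 < t \<Longrightarrow> h t < \<infinity>"
    and level: "\<And>v. 0 < v \<Longrightarrow> emeasure (lebesgue_on I) {s \<in> I. \<bar>x s\<bar> \<ge> v} < \<infinity>"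
    and t: "0 < t"
  shows "rearr I (level_pullback I x h) t \<le> h (t / 2)"
proof -
  let ?M = "lebesgue_on I" and ?y = "level_pullback I x h"
  have yL: "?y \<in> L0 I" by (rule level_pullback_L0[OF x h])
  define c where "c = enn2real (h (t / 2))"
  have c: "h (t / 2) = ennreal c" "0 \<le> c" using fin[of "t / 2"] t by (auto simp: c_def)
  have small: "emeasure ?M {u \<in> I. \<bar>x u\<bar> \<ge> \<bar>x s\<bar>} < ennreal t" if s: "c < \<bar>?y s\<bar>" for s
  proof -
    define d where "d = enn2real (emeasure ?M {u \<in> I. \<bar>x u\<bar> \<ge> \<bar>x s\<bar>})"
    have "c < ?y s" using s level_pullback_nonneg[of I x h s] by simp
    then have d: "0 < \<bar>x s\<bar>" "0 < d" "c < enn2real (h (d / 2))"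
      using c by (auto simp: level_pullback_def Let_def d_def split: if_splits)
    have "d < t"
    proof (rule ccontr)
      assume "\<not> d < t"
      then have "h (d / 2) \<le> h (t / 2)" by (intro antimonoD[OF h]) auto
      then have "enn2real (h (d / 2)) \<le> c"
        unfolding c_def using fin[of "t / 2"] t by (intro enn2real_mono) auto
      then show False using d by simp
    qed
    moreover have "emeasure ?M {u \<in> I. \<bar>x u\<bar> \<ge> \<bar>x s\<bar>} = ennreal d"
      unfolding d_def using level[OF d(1)] by simp
    ultimately show ?thesis using d by (simp add: ennreal_lessI)
  qed
  have "emeasure ?M {s \<in> I. \<bar>?y s\<bar> > c} \<le> ennreal t"
    by (rule emeasure_small_levels[OF x]) (use small in auto)
  then show ?thesis using rearr_le_iff[OF yL c(2)] c(1) by simp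
qed

text \<open>At points whose level set has measure 0 the pullback is 0 and cannot majorise x. By
  \<open>emeasure_small_levels\<close> these points form a set of measure at most e for every e >
  0.\<close>

lemma AE_level_positive:
  assumes I: "std_interval I" and x: "x \<in> L0 I"
  shows "AE s in lebesgue_on I. emeasure (lebesgue_on I) {u \<in> I. \<bar>x u\<bar> \<ge> \<bar>x s\<bar>} \<noteq> 0"
proof -
  let ?M = "lebesgue_on I"
  define D where "D v = emeasure ?M {u \<in> I. \<bar>x u\<bar> \<ge> v}" for v
  have "antimono D"
    unfolding D_def by (intro antimonoI emeasure_mono level_set_sets x) auto
  from antimono_borel_measurable[OF this] have [measurable]: "D \<in> borel_measurable borel" .
  have [measurable]: "x \<in> borel_measurable ?M" using x by (simp add: L0_def)
  define N where "N = {s \<in> space ?M. D \<bar>x s\<bar> = 0}"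
  have N: "N \<in> sets ?M" unfolding N_def by measurable
  have "emeasure ?M N \<le> 0"
  proof (rule ennreal_le_epsilon)
    fix e :: real assume "0 < e"
    then have "emeasure ?M N \<le> ennreal e"
      by (intro emeasure_small_levels[OF x]) (auto simp: N_def D_def)
    then show "emeasure ?M N \<le> 0 + ennreal e" by simp
  qed
  then have "N \<in> null_sets ?M" using N by auto
  then show ?thesis by (rule AE_I') (auto simp: N_def D_def)
qed

lemma symmetrization_level_pullback:
  assumes I: "std_interval I" and E: "solid_space I E" and A: "A \<in> dilation_consts I E"
    and x: "x \<in> L0 I" and h: "antimono h" "ext_mem I h E"
    and level: "\<And>v. 0 < v \<Longrightarrow> emeasure (lebesgue_on I) {s \<in> I. \<bar>x s\<bar> \<ge> v} < \<infinity>"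
  shows "level_pullback I x h \<in> elems (symmetrization I E)"
    "qnorm (symmetrization I E) (level_pullback I x h) \<le> A * ext_norm E h"
proof -
  have fin: "h t < \<infinity>" if "0 < t" for t
    using antimono_finite[OF I h(1) _ that] h(2) by (simp add: ext_mem_def)
  note dil = dilation_antimono[OF I E A h]
  have "rearr I (level_pullback I x h) t \<le> ennreal (enn2real (h (t / 2)))" if "0 < t" for t
    using rearr_level_pullback[OF I x h(1) fin level that] fin[of "t / 2"] that by simp
  then have "AE t in lebesgue_on I. rearr I (level_pullback I x h) t \<le> ennreal (enn2real (h (t / 2)))"
    using std_interval_pos[OF I] by (intro AE_I2) auto
  note mem = ext_mem_ideal[OF E dil(1) rearr_antimono this]
  show "level_pullback I x h \<in> elems (symmetrization I E)"
    using mem(1) level_pullback_L0[OF x h(1)] by (simp add: elems_symmetrization)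
  show "qnorm (symmetrization I E) (level_pullback I x h) \<le> A * ext_norm E h"
    using mem(2) dil(2) by (simp add: qnorm_symmetrization)
qed

lemma Hstar_unit_ball:
  assumes E: "solid_space I E" and C: "C \<in> Hstar_consts I r E" and x: "x \<in> elems E" "qnorm E x \<le> 1"
  shows "ext_mem I (Hstar I r x) E" "ext_norm E (Hstar I r x) \<le> C"
proof -
  have "C * qnorm E x \<le> C * 1"
    using C x by (intro mult_left_mono) (auto simp: Hstar_consts_def)
  moreover have "ext_norm E (Hstar I r x) \<le> C * qnorm E x" using C x by (auto simp: Hstar_consts_def)
  ultimately show "ext_norm E (Hstar I r x) \<le> C" by simp
  show "ext_mem I (Hstar I r x) E" using C x by (auto simp: Hstar_consts_def)
qed

text \<open>Part (ii) at the level of admissible constants. For a fixed s with x s \<noteq> 0,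
  \<open>two_var_Hstar_estimate\<close> is used with v = |x s| on (d/2,d), and the two values of the
  Hardy operator it produces are exactly the values of the pullbacks at s. Their norms are at most A
  CE and B CF, and N is a common positive bound.\<close>

lemma CL_bounds_of_symmetrization:
  assumes I: "std_interval I" and P: "\<rho> \<in> class_P" and r: "0 < r"
    and E: "solid_space I E" "dilation_bounded I E" and F: "solid_space I F" "dilation_bounded I F"
    and A: "A \<in> dilation_consts I E" and B: "B \<in> dilation_consts I F"
    and CE: "CE \<in> Hstar_consts I r E" and CF: "CF \<in> Hstar_consts I r F"
    and N: "0 < N" "A * CE \<le> N" "B * CF \<le> N"
    and x: "x \<in> L0 I" and fin: "AE t in lebesgue_on I. rearr I x t < \<infinity>"
    and c: "c \<in> CL_bounds I \<rho> E F (\<lambda>t. enn2real (rearr I x t))"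
  shows "c * (2 powr (1 / r) * max 1 (2 powr (1 / r - 1))) * N
    \<in> CL_bounds I \<rho> (symmetrization I E) (symmetrization I F) x"
proof -
  let ?M = "lebesgue_on I" and ?k = "2 powr (1 / r) * max 1 (2 powr (1 / r - 1)) :: real"
  note SE = symmetrization_solid[OF I E] and SF = symmetrization_solid[OF I F]
  obtain x0 x1 where c0: "0 < c" and x0: "x0 \<in> elems E" "qnorm E x0 \<le> 1"
    and x1: "x1 \<in> elems F" "qnorm F x1 \<le> 1"
    and ae: "AE t in ?M. \<bar>enn2real (rearr I x t)\<bar> \<le> c * two_var \<rho> \<bar>x0 t\<bar> \<bar>x1 t\<bar>"
    using c by (auto simp: CL_bounds_def)
  have L: "x0 \<in> L0 I" "x1 \<in> L0 I" using solid_L0[OF E(1) x0(1)] solid_L0[OF F(1) x1(1)] .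
  have ae': "AE t in ?M. rearr I x t \<le> ennreal (c * two_var \<rho> \<bar>x0 t\<bar> \<bar>x1 t\<bar>)"
    using ae fin
  proof eventually_elim
    case (elim t)
    then have "ennreal (enn2real (rearr I x t)) \<le> ennreal (c * two_var \<rho> \<bar>x0 t\<bar> \<bar>x1 t\<bar>)"
      by (intro ennreal_leI) simp
    then show ?case using elim(2) by simp
  qed
  define h0 where "h0 = Hstar I r x0"
  define h1 where "h1 = Hstar I r x1"
  have anti: "antimono h0" "antimono h1" unfolding h0_def h1_def by (rule Hstar_antimono[OF r])+
  have h0: "ext_mem I h0 E" "ext_norm E h0 \<le> CE"
    unfolding h0_def using Hstar_unit_ball[OF E(1) CE x0] .
  have h1: "ext_mem I h1 F" "ext_norm F h1 \<le> CF"
    unfolding h1_def using Hstar_unit_ball[OF F(1) CF x1] .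
  have hfin: "h0 t < \<infinity>" "h1 t < \<infinity>" if "0 < t" for t
    using antimono_finite[OF I anti(1) _ that] antimono_finite[OF I anti(2) _ that] h0(1) h1(1)
    by (simp_all add: ext_mem_def)
  have level: "emeasure ?M {s \<in> I. \<bar>x s\<bar> \<ge> v} < \<infinity>" if "0 < v" for v
    using hfin[of "1 / 2"] unfolding h0_def h1_def
    by (intro emeasure_level_finite[OF I P r x c0 that ae' L(1) _ L(2)]) auto
  define y0 where "y0 = level_pullback I x h0"
  define y1 where "y1 = level_pullback I x h1"
  have A0: "0 \<le> A" "0 \<le> B" using A B by (auto simp: dilation_consts_def)
  note y0 = symmetrization_level_pullback[OF I E(1) A x anti(1) h0(1) level, folded y0_def]
  note y1 = symmetrization_level_pullback[OF I F(1) B x anti(2) h1(1) level, folded y1_def]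
  have "A * ext_norm E h0 \<le> A * CE" "B * ext_norm F h1 \<le> B * CF"
    using h0(2) h1(2) A0 by (intro mult_left_mono; simp)+
  then have norms: "qnorm (symmetrization I E) y0 \<le> N" "qnorm (symmetrization I F) y1 \<le> N"
    using y0(2) y1(2) N by linarith+
  have "AE s in ?M. s \<in> I" by (rule AE_I2) simp
  with AE_level_positive[OF I x]
  have "AE s in ?M. \<bar>x s\<bar> \<le> (c * ?k) * two_var \<rho> \<bar>y0 s\<bar> \<bar>y1 s\<bar>"
  proof eventually_elim
    case (elim s)
    show ?case
    proof (cases "x s = 0")
      case True
      then show ?thesis using c0 two_var_nonneg[OF P, of "\<bar>y1 s\<bar>"] by simp
    next
      case False
      then have v: "0 < \<bar>x s\<bar>" by simp
      \<comment> \<open>For t < d the level set has measure above t, so x*(t) \<ge> |x s|. Moreover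
        d is at most the measure of I, which keeps (d/2,d) inside I.\<close>
      define d where "d = enn2real (emeasure ?M {u \<in> I. \<bar>x u\<bar> \<ge> \<bar>x s\<bar>})"
      have d: "emeasure ?M {u \<in> I. \<bar>x u\<bar> \<ge> \<bar>x s\<bar>} = ennreal d"
        unfolding d_def using level[OF v] by simp
      have d0: "0 < d" using d elim by (auto simp: d_def ennreal_neg intro: ccontr)
      have "emeasure ?M {u \<in> I. \<bar>x u\<bar> \<ge> \<bar>x s\<bar>} \<le> emeasure ?M I"
        by (intro emeasure_mono) (auto simp: sets_restrict_space_iff std_interval_sets[OF I])
      then have "{0<..<d} \<subseteq> I" unfolding d by (rule std_interval_Ioo[OF I])
      then have dI: "{d / 2<..<d} \<subseteq> I" using d0 by auto
      have "AE t in ?M. t \<in> {d / 2<..<d} \<longrightarrow> \<bar>x s\<bar> \<le> c * two_var \<rho> \<bar>x0 t\<bar> \<bar>x1 t\<bar>"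
        using ae'
      proof (eventually_elim, intro impI)
        fix t assume t: "rearr I x t \<le> ennreal (c * two_var \<rho> \<bar>x0 t\<bar> \<bar>x1 t\<bar>)" "t \<in> {d / 2<..<d}"
        have "ennreal \<bar>x s\<bar> \<le> rearr I x t"
          using t(2) d0 by (intro rearr_ge[OF x v]) (simp add: d ennreal_lessI)
        then have "ennreal \<bar>x s\<bar> \<le> ennreal (c * two_var \<rho> \<bar>x0 t\<bar> \<bar>x1 t\<bar>)"
          using t(1) by (rule order_trans)
        then show "\<bar>x s\<bar> \<le> c * two_var \<rho> \<bar>x0 t\<bar> \<bar>x1 t\<bar>"
          using c0 two_var_nonneg[OF P, of "\<bar>x1 t\<bar>"] by (subst (asm) ennreal_le_iff) auto
      qed
      then have "\<bar>x s\<bar> \<le> c * ?k * two_var \<rho> (enn2real (h0 (d / 2))) (enn2real (h1 (d / 2)))"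
        by (rule two_var_Hstar_estimate[OF I P r L d0 dI v c0])
          (use hfin[of "d / 2"] d0 in \<open>simp_all add: h0_def h1_def\<close>)
      then show ?thesis
        using v d0 by (simp add: y0_def y1_def level_pullback_def Let_def d_def)
    qed
  qed
  then show ?thesis
    using c0 by (intro CL_boundsI[OF P SE SF _ N(1) y0(1) norms(1) y1(1) norms(2)]) auto
qed

subsection \<open>The main theorem\<close>

text \<open>Homogeneity and invariance under a.e. equality hold for S directly, because its
  functional is a Calderon-Lozanovskii norm of x*. Definiteness and the quasi-triangle inequality
  are pulled back from R through the two-sided estimate.\<close>

lemma symmetrization_CL_equivalent:
  fixes I \<rho> E F
  defines "R \<equiv> Calderon_Lozanovskii I \<rho> (symmetrization I E) (symmetrization I F)"
    and "S \<equiv> symmetrization I (Calderon_Lozanovskii I \<rho> E F)"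
  assumes P: "\<rho> \<in> class_P" and E: "solid_space I E" and F: "solid_space I F"
    and R: "quasi_normed_space I R" and eq: "elems S = elems R"
    and C1: "0 < C1" "\<And>x. x \<in> elems R \<Longrightarrow> qnorm S x \<le> C1 * qnorm R x"
    and C2: "\<And>x. x \<in> elems S \<Longrightarrow> qnorm R x \<le> C2 * qnorm S x"
  shows "quasi_normed_space I S" "equivalent_on (elems S) (qnorm S) (qnorm R)"
proof -
  have S_star: "(\<lambda>t. enn2real (rearr I x t)) \<in> elems (Calderon_Lozanovskii I \<rho> E F)" "x \<in> L0 I"
    if "x \<in> elems S" for x
    using that by (auto simp: S_def elems_symmetrization ext_mem_def)
  have S_norm: "qnorm S x = qnorm (Calderon_Lozanovskii I \<rho> E F) (\<lambda>t. enn2real (rearr I x t))" for x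
    by (simp add: S_def qnorm_symmetrization ext_norm_def)
  have S_nonneg: "0 \<le> qnorm S x" if "x \<in> elems S" for x
    unfolding S_norm by (rule qnorm_CL_nonneg[OF S_star(1)[OF that]])
  have R_lin: "linear_subspace I (elems R)" and R_norm: "quasi_norm I (elems R) (qnorm R)"
    using R by (auto simp: quasi_normed_space_def)
  have R_nonneg: "0 \<le> qnorm R x" if "x \<in> elems R" for x
    using R_norm that unfolding quasi_norm_def by blast
  have R_zero: "qnorm R x = 0 \<longleftrightarrow> (AE t in lebesgue_on I. x t = 0)" if "x \<in> elems R" for x
    using R_norm that unfolding quasi_norm_def by blast
  have R_add: "(\<lambda>t. x t + y t) \<in> elems R" if "x \<in> elems R" "y \<in> elems R" for x y
    using R_lin that unfolding linear_subspace_def by blast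
  obtain K where K: "1 \<le> K"
    "\<And>x y. x \<in> elems R \<Longrightarrow> y \<in> elems R \<Longrightarrow> qnorm R (\<lambda>t. x t + y t) \<le> K * (qnorm R x + qnorm R y)"
    using R_norm unfolding quasi_norm_def by metis
  \<comment> \<open>\<open>equivalent_on\<close> requires positive constants, and nothing is assumed
    about the sign of C2.\<close>
  define C where "C = max 1 C2"
  have C: "1 \<le> C" by (simp add: C_def)
  have RC: "qnorm R x \<le> C * qnorm S x" if "x \<in> elems S" for x
    using C2[OF that] mult_right_mono[of C2 C "qnorm S x"] S_nonneg[OF that] by (simp add: C_def)
  have "quasi_norm I (elems S) (qnorm S)"
    unfolding quasi_norm_def
  proof (intro conjI ballI allI impI)
    show "0 \<le> qnorm S x" if "x \<in> elems S" for x
      by (rule S_nonneg[OF that])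
    show "qnorm S x = 0 \<longleftrightarrow> (AE t in lebesgue_on I. x t = 0)" if x: "x \<in> elems S" for x
    proof -
      have "qnorm S x = 0 \<longleftrightarrow> qnorm R x = 0"
        using RC[OF x] C1(2)[of x] x S_nonneg[OF x] R_nonneg[of x] unfolding eq by auto
      then show ?thesis using R_zero x unfolding eq by simp
    qed
    show "qnorm S (\<lambda>t. c * x t) = \<bar>c\<bar> * qnorm S x" if x: "x \<in> elems S" for x c
      using CL_cmult(2)[OF P E F S_star(1)[OF x], of "\<bar>c\<bar>"]
      by (simp add: S_norm rearr_cmult[OF S_star(2)[OF x]] enn2real_mult)
    show "qnorm S x = qnorm S y" if "x \<in> elems S" "y \<in> elems S" "AE t in lebesgue_on I. x t = y t" for x y
      using rearr_cong_AE[OF S_star(2)[OF that(1)] S_star(2)[OF that(2)] that(3)] by (simp add: S_norm)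
    show "\<exists>K\<ge>1. \<forall>x\<in>elems S. \<forall>y\<in>elems S. qnorm S (\<lambda>t. x t + y t) \<le> K * (qnorm S x + qnorm S y)"
    proof (intro exI[of _ "max 1 (C1 * K * C)"] conjI ballI)
      fix x y assume xy: "x \<in> elems S" "y \<in> elems S"
      have "qnorm S (\<lambda>t. x t + y t) \<le> C1 * qnorm R (\<lambda>t. x t + y t)"
        using xy R_add C1(2) unfolding eq by blast
      also have "\<dots> \<le> C1 * (K * (qnorm R x + qnorm R y))"
        using xy K(2) C1(1) unfolding eq by (intro mult_left_mono) auto
      also have "\<dots> \<le> C1 * (K * (C * qnorm S x + C * qnorm S y))"
        using RC xy C1(1) K(1) by (intro mult_left_mono add_mono) auto
      also have "\<dots> = (C1 * K * C) * (qnorm S x + qnorm S y)" by (simp add: algebra_simps)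
      also have "\<dots> \<le> max 1 (C1 * K * C) * (qnorm S x + qnorm S y)"
        using S_nonneg xy by (intro mult_right_mono) auto
      finally show "qnorm S (\<lambda>t. x t + y t) \<le> max 1 (C1 * K * C) * (qnorm S x + qnorm S y)" .
    qed simp
  qed
  then show "quasi_normed_space I S"
    using R_lin by (simp add: quasi_normed_space_def eq)
  have "0 < 1 / C1" "0 < C" using C1(1) C by auto
  moreover have "1 / C1 * qnorm S x \<le> qnorm R x \<and> qnorm R x \<le> C * qnorm S x" if x: "x \<in> elems S" for x
    using C1 RC[OF x] x unfolding eq by (simp add: pos_divide_le_eq mult.commute)
  ultimately show "equivalent_on (elems S) (qnorm S) (qnorm R)"
    unfolding equivalent_on_def by blast
qed

theorem theorem1:
  fixes I :: "real set" and \<rho> :: "real \<Rightarrow> real" and E F :: fspace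
  assumes "I = {0<..<1} \<or> I = {0<..}"
    and "\<rho> \<in> class_P"
    and "quasi_Banach_ideal_space I E" and "quasi_Banach_ideal_space I F"
    and "elems (symmetrization I E) \<noteq> null_class I"
    and "elems (symmetrization I F) \<noteq> null_class I"
    and "dilation_bounded I E" and "dilation_bounded I F"
  defines "R \<equiv> Calderon_Lozanovskii I \<rho> (symmetrization I E) (symmetrization I F)"
    and "S \<equiv> symmetrization I (Calderon_Lozanovskii I \<rho> E F)"
  shows "(elems R \<noteq> null_class I \<and>
          elems R \<subseteq> elems S \<and>
          (\<exists>C1 \<le> max (dilation_const I E) (dilation_const I F).
             \<forall>x\<in>elems R. qnorm S x \<le> C1 * qnorm R x)) \<and>
         (\<forall>r>0. Hstar_bounded I r E \<and> Hstar_bounded I r F \<longrightarrow>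
          elems S \<subseteq> elems R \<and>
          (\<exists>C2 \<le> 2 powr (1 / r) * max 1 (2 powr (1 / r - 1)) *
                   max (dilation_const I E * Hstar_norm I r E)
                       (dilation_const I F * Hstar_norm I r F).
             \<forall>x\<in>elems S. qnorm R x \<le> C2 * qnorm S x) \<and>
          quasi_normed_space I S \<and>
          quasi_normed_space I R \<and>
          elems S = elems R \<and>
          equivalent_on (elems S) (qnorm S) (qnorm R))"
proof -
  have I: "std_interval I" using assms(1) by (simp add: std_interval_def)
  note P = assms(2)
  note E = quasi_Banach_ideal_space_solid[OF assms(3)] and F = quasi_Banach_ideal_space_solid[OF assms(4)]
  note A = dilation_const_mem[OF E assms(7)] and B = dilation_const_mem[OF F assms(8)]
  define C1 where "C1 = max (dilation_const I E) (dilation_const I F)"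
  \<comment> \<open>Best dilation constants are at least 1, so C1 may serve as a divisor in the
    equivalence of the two functionals.\<close>
  have C1: "0 < C1" using A by (auto simp: C1_def dilation_consts_def)
  note bounds = CL_bounds_symmetrization[OF I P E F A B, folded C1_def]
  have elems_R: "x \<in> L0 I" "CL_bounds I \<rho> (symmetrization I E) (symmetrization I F) x \<noteq> {}"
    if "x \<in> elems R" for x
    using that by (auto simp: R_def elems_CL)
  have qnorm_S: "qnorm S x = Inf (CL_bounds I \<rho> E F (\<lambda>t. enn2real (rearr I x t)))" for x
    by (simp add: S_def qnorm_symmetrization ext_norm_def qnorm_CL)
  have qnorm_R: "qnorm R x = Inf (CL_bounds I \<rho> (symmetrization I E) (symmetrization I F) x)" for x
    by (simp add: R_def qnorm_CL)
  have RS: "elems R \<subseteq> elems S"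
  proof
    fix x assume "x \<in> elems R"
    note x = elems_R[OF this]
    then obtain c where "c \<in> CL_bounds I \<rho> (symmetrization I E) (symmetrization I F) x" by blast
    from bounds(1)[OF x(1) this] show "x \<in> elems S" using x(1) by (simp add: S_def elems_symmetrization)
  qed
  have norm1: "qnorm S x \<le> C1 * qnorm R x" if "x \<in> elems R" for x
    unfolding qnorm_S qnorm_R
    by (rule Inf_mult_le[OF less_imp_le[OF C1] elems_R(2)[OF that] bounds(2)[OF elems_R(1)[OF that]] CL_bounds_nonneg])
  have R_ne: "elems R \<noteq> null_class I"
    unfolding R_def using CL_symmetrization_nontrivial[OF I P E assms(7,5) F assms(8,6)] .
  have part2: "elems S \<subseteq> elems R \<and>
          (\<exists>C2 \<le> 2 powr (1 / r) * max 1 (2 powr (1 / r - 1)) *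
                   max (dilation_const I E * Hstar_norm I r E)
                       (dilation_const I F * Hstar_norm I r F).
             \<forall>x\<in>elems S. qnorm R x \<le> C2 * qnorm S x) \<and>
          quasi_normed_space I S \<and>
          quasi_normed_space I R \<and>
          elems S = elems R \<and>
          equivalent_on (elems S) (qnorm S) (qnorm R)"
    if r: "0 < r" and H: "Hstar_bounded I r E" "Hstar_bounded I r F" for r
  proof -
    define k :: real where "k = 2 powr (1 / r) * max 1 (2 powr (1 / r - 1))"
    define M where "M = max (dilation_const I E * Hstar_norm I r E) (dilation_const I F * Hstar_norm I r F)"
    have k: "0 < k" by (simp add: k_def)
    note HE = Hstar_norm_mem[OF E H(1)] and HF = Hstar_norm_mem[OF F H(2)]
    have "0 \<le> dilation_const I E * Hstar_norm I r E"
      using A HE by (intro mult_nonneg_nonneg) (auto simp: dilation_consts_def Hstar_consts_def)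
    then have M: "0 \<le> M" by (simp add: M_def)
    have elems_S: "x \<in> L0 I" "AE t in lebesgue_on I. rearr I x t < \<infinity>"
      "CL_bounds I \<rho> E F (\<lambda>t. enn2real (rearr I x t)) \<noteq> {}" if "x \<in> elems S" for x
      using that by (auto simp: S_def elems_symmetrization ext_mem_def elems_CL)
    \<comment> \<open>\<open>N = M\<close> itself is not available since \<open>M\<close> might vanish.\<close>
    have bound: "k * N * c \<in> CL_bounds I \<rho> (symmetrization I E) (symmetrization I F) x"
      if "x \<in> elems S" "c \<in> CL_bounds I \<rho> E F (\<lambda>t. enn2real (rearr I x t))" "M < N" for x c N
    proof -
      have "0 < N" "dilation_const I E * Hstar_norm I r E \<le> N" "dilation_const I F * Hstar_norm I r F \<le> N"
        using that(3) M by (auto simp: M_def)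
      from CL_bounds_of_symmetrization[OF I P r E assms(7) F assms(8) A B HE HF this
          elems_S(1,2)[OF that(1)] that(2), folded k_def]
      show ?thesis by (simp add: mult_ac)
    qed
    have SR: "elems S \<subseteq> elems R"
    proof
      fix x assume x: "x \<in> elems S"
      obtain c where "c \<in> CL_bounds I \<rho> E F (\<lambda>t. enn2real (rearr I x t))" using elems_S(3)[OF x] by blast
      from bound[OF x this, of "M + 1"] show "x \<in> elems R"
        using elems_S(1)[OF x] by (auto simp: R_def elems_CL)
    qed
    have norm2: "qnorm R x \<le> (k * M) * qnorm S x" if x: "x \<in> elems S" for x
    proof -
      have S0: "0 \<le> qnorm S x"
        unfolding qnorm_S by (intro cInf_greatest elems_S(3)[OF x] CL_bounds_nonneg)
      have le: "qnorm R x \<le> k * N * qnorm S x" if "M < N" for N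
        unfolding qnorm_S qnorm_R
      proof (rule Inf_mult_le[OF _ elems_S(3)[OF x]])
        show "0 \<le> k * N" using k M that by simp
        show "k * N * c \<in> CL_bounds I \<rho> (symmetrization I E) (symmetrization I F) x"
          if "c \<in> CL_bounds I \<rho> E F (\<lambda>t. enn2real (rearr I x t))" for c
          by (rule bound[OF x that \<open>M < N\<close>])
      qed (rule CL_bounds_nonneg)
      show ?thesis
      proof (rule field_le_epsilon)
        fix e :: real assume e: "0 < e"
        \<comment> \<open>The constant M is reached as the limit of N = M + e/q. This q makes the
          excess over k M times the norm at most e, and the added 1 keeps q positive when the norm
          of x is 0.\<close>
        define q where "q = k * (qnorm S x + 1)"
        have q: "0 < q" "k * qnorm S x \<le> q" using k S0 by (auto simp: q_def)
        have "qnorm R x \<le> k * (M + e / q) * qnorm S x"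
          using e q by (intro le) simp
        also have "\<dots> = k * M * qnorm S x + (e / q) * (k * qnorm S x)" by (simp add: algebra_simps)
        also have "\<dots> \<le> k * M * qnorm S x + (e / q) * q"
          using e q by (intro add_left_mono mult_left_mono) auto
        finally show "qnorm R x \<le> k * M * qnorm S x + e" using q by simp
      qed
    qed
    have eq: "elems S = elems R" using RS SR by blast
    have R_qn: "quasi_normed_space I R"
      unfolding R_def by (rule CL_symmetrization_quasi_normed[OF I P E assms(7) F assms(8)])
    have "quasi_normed_space I S" "equivalent_on (elems S) (qnorm S) (qnorm R)"
      using symmetrization_CL_equivalent[OF P E F, folded R_def S_def, OF R_qn eq C1 norm1 norm2] by blast+
    moreover have "\<exists>C2\<le>k * M. \<forall>x\<in>elems S. qnorm R x \<le> C2 * qnorm S x"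
      using norm2 by blast
    ultimately show ?thesis
      using SR eq R_qn unfolding k_def M_def by blast
  qed
  have part1: "elems R \<noteq> null_class I \<and> elems R \<subseteq> elems S \<and>
      (\<exists>C1 \<le> max (dilation_const I E) (dilation_const I F). \<forall>x\<in>elems R. qnorm S x \<le> C1 * qnorm R x)"
    using R_ne RS norm1 unfolding C1_def by blast
  show ?thesis using part1 part2 by blast
qed

end
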